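(* For every positive integer $n$, let $\Delta_n\subset\mathbb{R}^{n^3}$ be the polytope of $n\times n\times n$ tristochastic arrays. As $n\to\infty$, $\Delta_n$ has at least $n^{(2-o(1))n^2}$ vertices. That is, for every $\varepsilon>0$ there exists $n_0$ such that for all $n\ge n_0$ the number of vertices of $\Delta_n$ is at least $n^{(2-\varepsilon)n^2}$.
   Context: A line of an $n\times n\times n$ real array $M$ is a set of $n$ entries obtained by fixing two of the three coordinates and letting the third vary, i.e. a set of the form $M(\cdot,j,k)$ (a column), $M(i,\cdot,k)$ (a row) or $M(i,j,\cdot)$ (a shaft). An $n\times n\times n$ array of nonnegative reals is tristochastic if the entries of every line sum to $1$. $\Delta_n\subset\mathbb{R}^{n^3}$ denotes the polytope of all such arrays. A vertex of $\Delta_n$ is an extreme point of it. *)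

theory Defs
  imports "HOL-Analysis.Analysis" "HOL-Analysis.Finite_Function_Topology"
begin

(* The dimension n^3 varies with a natural number n, so R^(n^3) cannot be a type depending on n.
   An n x n x n array is instead a finitely supported function on index triples that vanishes
   outside {..<n}^3; these functions form a copy of R^(n^3) inside the real vector space
   nat * nat * nat =>0 real. Coordinates run over 0, ..., n - 1 rather than 1, ..., n. *)

definition arrays :: "nat \<Rightarrow> ((nat \<times> nat \<times> nat) \<Rightarrow>\<^sub>0 real) set" where
  "arrays n = {M. Poly_Mapping.keys M \<subseteq> {..<n} \<times> {..<n} \<times> {..<n}}"

abbreviation entry :: "((nat \<times> nat \<times> nat) \<Rightarrow>\<^sub>0 real) \<Rightarrow> nat \<Rightarrow> nat \<Rightarrow> nat \<Rightarrow> real" where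
  "entry M i j k \<equiv> Poly_Mapping.lookup M (i, j, k)"

(* The last three conditions range over the columns, the rows and the shafts, in this order. *)
definition tristochastic :: "nat \<Rightarrow> ((nat \<times> nat \<times> nat) \<Rightarrow>\<^sub>0 real) \<Rightarrow> bool" where
  "tristochastic n M \<longleftrightarrow>
     M \<in> arrays n \<and>
     (\<forall>i<n. \<forall>j<n. \<forall>k<n. 0 \<le> entry M i j k) \<and>
     (\<forall>j<n. \<forall>k<n. (\<Sum>i<n. entry M i j k) = 1) \<and>
     (\<forall>i<n. \<forall>k<n. (\<Sum>j<n. entry M i j k) = 1) \<and>
     (\<forall>i<n. \<forall>j<n. (\<Sum>k<n. entry M i j k) = 1)"

definition tristochastic_polytope :: "nat \<Rightarrow> ((nat \<times> nat \<times> nat) \<Rightarrow>\<^sub>0 real) set" where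
  "tristochastic_polytope n = {M. tristochastic n M}"

definition vertices :: "'a::real_vector set \<Rightarrow> 'a set" where
  "vertices P = {v. v extreme_point_of P}"

end

theory Submission
  imports Defs "HOL-Computational_Algebra.Fundamental_Theorem_Algebra"
begin

text \<open>A tristochastic array is a vertex as soon as no nonzero array supported on its support has
  vanishing line sums. Split all but a few rows into \<open>q\<close> groups of \<open>r\<close> rows and the pairs
  (column, symbol) into \<open>q\<close> classes, each an \<open>r\<close>-regular bipartite graph. A row group \<open>g \<ge> 3\<close>
  carries, with weight \<open>1/2\<close> each, an arbitrary 1-factorization of class \<open>g\<close> and an arbitrary
  1-factorization of class \<open>g + 1\<close> (cyclically). The groups \<open>0, 1, 2\<close> form a fixed gadget with an
  odd cycle, on which an array with vanishing line sums must be zero; the zero then propagates from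
  group to group through the lines in row direction, whatever the 1-factorizations are. For
  constant \<open>q\<close> this yields about \<open>r ^ (2 (q - 3) r n)\<close> vertices, because a \<open>d\<close>-regular bipartite
  graph on \<open>n + n\<close> points has at least \<open>(d / e) ^ n\<close> perfect matchings. The latter is the
  van der Waerden bound without its polynomial factor, proved by Gurvits' capacity method.\<close>

text \<open>A fixed gadget cannot be avoided by a purely cyclic scheme: if every group
  \<open>g\<close> carried class \<open>g\<close> and its cyclic successor, the array equal to
  \<open>1\<close> on the first and \<open>-1\<close> on the second class of each group would have
  vanishing line sums. Three groups are spent on breaking this sign alternation, which only lowers
  the exponent \<open>2\<close> to \<open>2 * (q - 3) / q\<close>. The \<open>2\<close> itself
  arises because every (row, column) position of a free group holds two symbols, each contributing a
  factor of order \<open>r\<close>. Propagation ignores the choices because a 1-factorization uses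
  each (column, symbol) pair of its class exactly once, so a line in row direction meets it in
  exactly one row of the group. For \<open>g >= 3\<close> class \<open>g\<close> lives only in the
  groups \<open>g - 1\<close> and \<open>g\<close>: zeros in group \<open>g - 1\<close> force zeros
  on class \<open>g\<close> of group \<open>g\<close>, and sums over symbols force zeros on its
  successor class. Sums over columns enter the rigidity argument only inside the gadget.\<close>

subsection \<open>Permanents of doubly stochastic matrices\<close>

text \<open>This is the polynomial \<open>\<Prod>i\<in>R. \<Sum>j<m + k. a i j * z j\<close> differentiated once at \<open>0\<close> in each of the
  variables \<open>z m, \<dots>, z (m + k - 1)\<close>. For \<open>m = 0\<close> and \<open>card R = k\<close> it is the
  permanent of \<open>a\<close>.\<close>

primrec mixed :: "(nat \<Rightarrow> nat \<Rightarrow> 'a::comm_ring_1) \<Rightarrow> nat \<Rightarrow> nat \<Rightarrow> nat set \<Rightarrow> (nat \<Rightarrow> 'a) \<Rightarrow> 'a" where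
  "mixed a 0 = (\<lambda>m R z. \<Prod>i\<in>R. \<Sum>j<m. a i j * z j)"
| "mixed a (Suc k) = (\<lambda>m R z. \<Sum>i\<in>R. a i (m + k) * mixed a k m (R - {i}) z)"

lemma mixed_of_real:
  "mixed (\<lambda>i j. of_real (a i j)) k m R (\<lambda>j. of_real (x j)) =
     (of_real (mixed a k m R x) :: 'a::{real_algebra_1,comm_ring_1})"
  by (induction k arbitrary: R) simp_all

text \<open>Each differentiation lowers the degree by one. Applied with complex \<open>c\<close>,
  this rotates the arguments and turns half-plane stability into real-rootedness.\<close>

lemma mixed_homogeneous:
  assumes "finite R" "k \<le> card R"
  shows "mixed a k m R (\<lambda>j. c * z j) = c ^ (card R - k) * mixed a k m R z"
  using assms
proof (induction k arbitrary: R)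
  case 0
  have "mixed a 0 m R (\<lambda>j. c * z j) = (\<Prod>i\<in>R. c * (\<Sum>j<m. a i j * z j))"
    by (simp add: sum_distrib_left mult_ac)
  then show ?case by (simp add: prod.distrib)
next
  case (Suc k)
  have "mixed a k m (R - {i}) (\<lambda>j. c * z j) = c ^ (card R - Suc k) * mixed a k m (R - {i}) z"
    if "i \<in> R" for i
    using Suc.IH[of "R - {i}"] Suc.prems that by simp
  then show ?case by (simp add: sum_distrib_left mult_ac)
qed

lemma mixed_scale:
  assumes "finite R" "card R = k"
  shows "mixed (\<lambda>i j. c * a i j) k 0 R z = c ^ k * mixed a k 0 R z"
  using assms
proof (induction k arbitrary: R)
  case (Suc k)
  have "mixed (\<lambda>i j. c * a i j) k 0 (R - {i}) z = c ^ k * mixed a k 0 (R - {i}) z"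
    if "i \<in> R" for i
    using Suc.IH[of "R - {i}"] Suc.prems that by simp
  then show ?case by (simp add: sum_distrib_left mult_ac)
qed simp

lemma mixed_cong:
  "(\<And>j. j < m \<Longrightarrow> z j = z' j) \<Longrightarrow> mixed a k m R z = mixed a k m R z'"
  by (induction k arbitrary: R) simp_all

lemma mixed_nonneg:
  fixes a :: "nat \<Rightarrow> nat \<Rightarrow> real"
  assumes "\<And>i j. 0 \<le> a i j" "\<And>j. 0 \<le> z j"
  shows "0 \<le> mixed a k m R z"
  using assms by (induction k arbitrary: R) (auto intro!: prod_nonneg sum_nonneg)

lemma mixed_pos:
  fixes a :: "nat \<Rightarrow> nat \<Rightarrow> real"
  assumes "\<And>i j. 0 < a i j" "\<And>j. 0 < z j" "0 < m" "finite R" "k \<le> card R"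
  shows "0 < mixed a k m R z"
  using assms
proof (induction k arbitrary: R)
  case 0
  then show ?case by (auto intro!: prod_pos sum_pos)
next
  case (Suc k)
  then show ?case by (auto intro!: sum_pos mult_pos_pos)
qed

text \<open>Freezing all variables except \<open>z m\<close> turns the next differentiation at
  \<open>0\<close> into \<open>pderiv\<close>. The coefficient at \<open>card R - k\<close> is built
  from positive entries without cancellation; it certifies a positive degree in
  \<open>mixed_stable\<close>.\<close>

lemma mixed_polynomial:
  fixes a :: "nat \<Rightarrow> nat \<Rightarrow> real" and z :: "nat \<Rightarrow> complex"
  defines "A \<equiv> \<lambda>i j. complex_of_real (a i j)"
  assumes "finite R" "k \<le> card R" "\<And>i j. 0 < a i j"
  shows "\<exists>p s. (\<forall>t. mixed A k (Suc m) R (z(m := t)) = poly p t) \<and>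
      poly (pderiv p) 0 = mixed A (Suc k) m R z \<and>
      coeff p (card R - k) = complex_of_real s \<and> 0 < s"
  using assms(2,3)
proof (induction k arbitrary: R)
    case 0
    define p where "p = (\<Prod>i\<in>R. [:\<Sum>j<m. A i j * z j, A i m:])"
    have A0: "A i m \<noteq> 0" for i
      using assms(4)[of i m] by (simp add: A_def)
    have 1: "mixed A 0 (Suc m) R (z(m := t)) = poly p t" for t
      by (simp add: p_def poly_prod algebra_simps)
    have 2: "poly (pderiv p) 0 = mixed A (Suc 0) m R z"
      by (simp add: p_def pderiv_prod poly_sum poly_prod pderiv_pCons mult.commute)
    have "degree p = card R"
      unfolding p_def using A0 by (subst degree_prod_eq_sum_degree) auto
    then have "coeff p (card R - 0) = lead_coeff p" by simp
    also have "\<dots> = complex_of_real (\<Prod>i\<in>R. a i m)"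
      using A0 by (simp add: p_def lead_coeff_prod A_def)
    finally have "coeff p (card R - 0) = complex_of_real (\<Prod>i\<in>R. a i m)" .
    moreover note 1 2
    moreover have "(\<Prod>i\<in>R. a i m) > 0"
      using assms(4) by (intro prod_pos) auto
    ultimately show ?case by blast
  next
    case (Suc k)
    have "\<exists>p s. (\<forall>t. mixed A k (Suc m) (R - {i}) (z(m := t)) = poly p t) \<and>
      poly (pderiv p) 0 = mixed A (Suc k) m (R - {i}) z \<and>
      coeff p (card R - Suc k) = complex_of_real s \<and> 0 < s" if "i \<in> R" for i
      using Suc.IH[of "R - {i}"] Suc.prems that by (simp del: mixed.simps fun_upd_apply)
    then obtain p s where ps: "\<And>i t. i \<in> R \<Longrightarrow> mixed A k (Suc m) (R - {i}) (z(m := t)) = poly (p i) t"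
      "\<And>i. i \<in> R \<Longrightarrow> poly (pderiv (p i)) 0 = mixed A (Suc k) m (R - {i}) z"
      "\<And>i. i \<in> R \<Longrightarrow> coeff (p i) (card R - Suc k) = complex_of_real (s i)"
      "\<And>i. i \<in> R \<Longrightarrow> 0 < s i"
      by metis
    define P where "P = (\<Sum>i\<in>R. smult (A i (Suc m + k)) (p i))"
    have "mixed A (Suc k) (Suc m) R (z(m := t)) = poly P t" for t
      by (simp add: P_def poly_sum ps(1))
    moreover have "poly (pderiv P) 0 = (\<Sum>i\<in>R. A i (m + Suc k) * mixed A (Suc k) m (R - {i}) z)"
      by (simp add: P_def higher_pderiv_sum[of 1, simplified] pderiv_smult poly_sum ps(2) del: mixed.simps)
    then have "poly (pderiv P) 0 = mixed A (Suc (Suc k)) m R z"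
      by simp
    moreover have "coeff P (card R - Suc k) = complex_of_real (\<Sum>i\<in>R. a i (Suc m + k) * s i)"
      by (simp add: P_def coeff_sum ps(3) A_def)
    moreover have "(\<Sum>i\<in>R. a i (Suc m + k) * s i) > 0"
      using Suc.prems ps(4) assms(4) by (intro sum_pos) auto
    ultimately show ?case by blast
qed

section \<open>Half-plane stability\<close>

lemma linear_product_log_deriv:
  fixes A :: "complex multiset"
  assumes "0 \<notin># A"
  shows "poly (\<Prod>w\<in>#A. [:-w, 1:]) 0 \<noteq> 0 \<and>
    poly (pderiv (\<Prod>w\<in>#A. [:-w, 1:])) 0 = poly (\<Prod>w\<in>#A. [:-w, 1:]) 0 * (\<Sum>w\<in>#A. - 1 / w)"
  using assms
proof (induction A)
  case (add w A)
  define P where "P = (\<Prod>w\<in>#A. [:-w, 1:])"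
  have IH: "poly P 0 \<noteq> 0" "poly (pderiv P) 0 = poly P 0 * (\<Sum>w\<in>#A. - 1 / w)" and w: "w \<noteq> 0"
    using add by (auto simp: P_def)
  have eq: "(\<Prod>w\<in>#add_mset w A. [:-w, 1:]) = [:-w, 1:] * P"
    unfolding P_def by (simp only: image_mset_add_mset prod_mset.add_mset)
  have 1: "poly (pderiv ([:-w, 1:] * P)) 0 = - w * poly (pderiv P) 0 + poly P 0"
    by (simp only: pderiv_mult poly_add poly_mult) (simp add: pderiv_pCons)
  have 2: "poly ([:-w, 1:] * P) 0 = - w * poly P 0"
    by (simp only: poly_mult) simp
  show ?case unfolding eq 1 2 using IH w by (simp add: field_simps)
qed simp

text \<open>The logarithmic derivative at \<open>0\<close> is the sum of \<open>- 1 / w\<close> over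
  the roots \<open>w\<close>, and each term has positive real part when
  \<open>Re w < 0\<close>.\<close>

lemma pderiv_nonzero_left_roots:
  fixes p :: "complex poly"
  assumes "degree p > 0" "\<And>w. poly p w = 0 \<Longrightarrow> Re w < 0"
  shows "poly (pderiv p) 0 \<noteq> 0"
proof -
  obtain A where A: "size A = degree p" "p = smult (lead_coeff p) (\<Prod>w\<in>#A. [:-w, 1:])"
    using alg_closed_imp_factorization[of p] assms(1) by (metis degree_0 less_irrefl)
  have lc: "lead_coeff p \<noteq> 0" using assms(1) by auto
  have root: "Re w < 0" if "w \<in># A" for w
  proof -
    have "poly (\<Prod>w\<in>#A. [:-w, 1:]) w = 0"
      using that by (auto simp: poly_prod_mset)
    then show ?thesis by (intro assms(2)) (subst A(2), simp)
  qed
  have "0 \<notin># A" using root[of 0] by auto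
  note ld = linear_product_log_deriv[OF this]
  have pos: "A \<noteq> {#} \<longrightarrow> 0 < Re (\<Sum>w\<in>#A. - 1 / w)" using root
  proof (induction A)
    case (add w A)
    have "0 < Re (- 1 / w)"
      using add.prems[of w] by (auto simp: Re_divide intro!: divide_neg_pos sum_power2_gt_zero_iff[THEN iffD2])
    then show ?case using add by (cases "A = {#}") auto
  qed simp
  have "A \<noteq> {#}" using A(1) assms(1) by auto
  with pos have "(\<Sum>w\<in>#A. - 1 / w) \<noteq> 0" by force
  then show ?thesis
    using ld lc by (subst A(2)) (simp add: pderiv_smult)
qed

text \<open>The half-plane property passes from a polynomial to its derivative at \<open>0\<close> in one variable by
  the Gauss--Lucas argument.\<close>

lemma mixed_stable:
  fixes a :: "nat \<Rightarrow> nat \<Rightarrow> real" and z :: "nat \<Rightarrow> complex"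
  assumes a: "\<And>i j. 0 < a i j"
    and "finite R" "card R = k + m" "\<And>j. j < m \<Longrightarrow> 0 \<le> Re (z j)" "\<exists>j<m. 0 < Re (z j)"
  shows "mixed (\<lambda>i j. complex_of_real (a i j)) k m R z \<noteq> 0"
  using assms(2-)
proof (induction k arbitrary: m R z)
  case 0
  obtain j0 where j0: "j0 < m" "0 < Re (z j0)" using 0 by blast
  have "0 < (\<Sum>j<m. a i j * Re (z j))" for i
  proof (rule sum_pos2[of _ j0])
    show "0 < a i j0 * Re (z j0)" using a j0 by simp
    show "\<And>j. j \<in> {..<m} \<Longrightarrow> 0 \<le> a i j * Re (z j)"
      using 0(3) a by (auto simp: less_imp_le)
  qed (use j0 in auto)
  then have "0 < Re (\<Sum>j<m. complex_of_real (a i j) * z j)" for i by simp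
  then have "(\<Sum>j<m. complex_of_real (a i j) * z j) \<noteq> 0" for i
    by (metis less_irrefl zero_complex.sel(1))
  then show ?case using 0 by simp
next
  case (Suc k)
  have "k \<le> card R" using Suc.prems by simp
  then obtain p s where p: "\<And>t. mixed (\<lambda>i j. complex_of_real (a i j)) k (Suc m) R (z(m := t)) = poly p t"
    "poly (pderiv p) 0 = mixed (\<lambda>i j. complex_of_real (a i j)) (Suc k) m R z"
    "coeff p (card R - k) = complex_of_real s" "0 < s"
    using mixed_polynomial[where a = a and z = z and m = m, OF Suc.prems(1) _ a] by blast
  have "coeff p (Suc m) \<noteq> 0" using p(3,4) Suc.prems by simp
  then have "degree p > 0" using le_degree[of p "Suc m"] by simp
  \<comment> \<open>A root with \<open>0 <= Re w\<close> would be an admissible value of the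
    additional variable, which is why the hypothesis allows the closed half-plane; the required
    strict inequality is inherited from \<open>z\<close>.\<close>
  moreover have "Re w < 0" if "poly p w = 0" for w
  proof (rule ccontr)
    assume "\<not> Re w < 0"
    moreover obtain j where "j < m" "0 < Re (z j)" using Suc.prems by blast
    then have "\<exists>j<Suc m. 0 < Re ((z(m := w)) j)" by (intro exI[of _ j]) auto
    ultimately have "mixed (\<lambda>i j. complex_of_real (a i j)) k (Suc m) R (z(m := w)) \<noteq> 0"
      using Suc.prems by (intro Suc.IH) (auto simp: less_Suc_eq)
    then show False using p(1) that by simp
  qed
  ultimately show ?case using pderiv_nonzero_left_roots p(2) by metis
qed

text \<open>Up to the value at \<open>0\<close>, the polynomial is a product of factors
  \<open>1 - t / w\<close> with \<open>w\<close> a negative real, and each is at most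
  \<open>exp (- t / w)\<close>. The number \<open>s\<close> is the logarithmic derivative at
  \<open>0\<close>.\<close>

lemma poly_le_exp_negative_roots:
  fixes p :: "complex poly"
  assumes p0: "poly p 0 \<noteq> 0" and roots: "\<And>w. poly p w = 0 \<Longrightarrow> w \<in> \<real> \<and> Re w < 0"
  shows "\<exists>s. poly (pderiv p) 0 = poly p 0 * of_real s \<and>
    (\<forall>t\<ge>0. \<exists>E. poly p (of_real t) = poly p 0 * of_real E \<and> E \<le> exp (t * s))"
proof -
  obtain A where A: "p = smult (lead_coeff p) (\<Prod>w\<in>#A. [:-w, 1:])"
    using alg_closed_imp_factorization[of p] p0 by (metis poly_0)
  have root: "w \<in> \<real> \<and> Re w < 0" if "w \<in># A" for w
  proof -
    have "poly (\<Prod>w\<in>#A. [:-w, 1:]) w = 0"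
      using that by (auto simp: poly_prod_mset)
    then show ?thesis by (intro roots) (subst A, simp)
  qed
  define s where "s = (\<Sum>w\<in>#A. - 1 / Re w)"
  have "0 \<notin># A" using root[of 0] by auto
  note ld = linear_product_log_deriv[OF this]
  have "(\<Sum>w\<in>#A. - 1 / w) = of_real s"
    using root unfolding s_def
  proof (induction A)
    case (add w A)
    then have "w = of_real (Re w)" by auto
    then have "- 1 / w = of_real (- 1 / Re w)"
      by (metis of_real_1 of_real_divide of_real_minus)
    then show ?case using add by simp
  qed simp
  then have 1: "poly (pderiv p) 0 = poly p 0 * of_real s"
    using ld by (subst (1 2) A) (simp add: pderiv_smult)
  have "\<exists>E. poly p (of_real t) = poly p 0 * of_real E \<and> E \<le> exp (t * s)" if t: "0 \<le> t" for t
  proof -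
    have "\<exists>E\<ge>0. poly (\<Prod>w\<in>#A. [:-w, 1:]) (of_real t) = poly (\<Prod>w\<in>#A. [:-w, 1:]) 0 * of_real E \<and> E \<le> exp (t * s)"
      using root unfolding s_def
    proof (induction A)
      case empty
      show ?case by (intro exI[of _ 1]) simp
    next
      case (add w A)
      then obtain E where E: "E \<ge> 0" "poly (\<Prod>w\<in>#A. [:-w, 1:]) (of_real t) = poly (\<Prod>w\<in>#A. [:-w, 1:]) 0 * of_real E"
        "E \<le> exp (t * (\<Sum>w\<in>#A. - 1 / Re w))" by auto
      have w: "w = of_real (Re w)" "Re w < 0" using add.prems[of w] by auto
      define F where "F = 1 + t * (- 1 / Re w)"
      have F: "0 \<le> F" using w(2) t by (simp add: F_def field_simps)
      have "F \<le> exp (t * (- 1 / Re w))" unfolding F_def by (rule exp_ge_add_one_self)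
      then have "F * E \<le> exp (t * (- 1 / Re w)) * exp (t * (\<Sum>w\<in>#A. - 1 / Re w))"
        using E F by (intro mult_mono) auto
      also have "\<dots> = exp (t * (\<Sum>w\<in>#add_mset w A. - 1 / Re w))"
        by (simp add: exp_add[symmetric] algebra_simps)
      finally have "F * E \<le> exp (t * (\<Sum>w\<in>#add_mset w A. - 1 / Re w))" .
      moreover have "of_real t - w = - w * of_real F"
        using w(2) by (subst (1 2) w(1)) (simp add: F_def field_simps less_imp_neq flip: of_real_diff of_real_mult of_real_minus of_real_add)
      then have "poly (\<Prod>w\<in>#add_mset w A. [:-w, 1:]) (of_real t) = poly (\<Prod>w\<in>#add_mset w A. [:-w, 1:]) 0 * of_real (F * E)"
        using E(2) by (simp del: mult_pCons_left)
      ultimately show ?case using E F by (intro exI[of _ "F * E"]) auto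
    qed
    then show ?thesis by (subst (1 2) A) auto
  qed
  then show ?thesis using 1 by blast
qed

text \<open>Gurvits' step: \<open>C\<close> bounds the capacity from below, and differentiating away
  one variable costs at most a factor \<open>e\<close>. The restriction \<open>p\<close> to that
  variable satisfies \<open>C * X * t <= p t\<close> and \<open>p t <= p 0 * exp (t * s)\<close>
  with \<open>p 0 * s\<close> its derivative at \<open>0\<close>; the two bounds are compared at one
  \<open>t\<close>.\<close>

lemma mixed_capacity_step:
  fixes a :: "nat \<Rightarrow> nat \<Rightarrow> real"
  assumes a: "\<And>i j. 0 < a i j" and R: "finite R" "card R = k + Suc m" and "0 < C"
    and cap: "\<And>x. (\<And>j. 0 < x j) \<Longrightarrow> C * (\<Prod>j<Suc m. x j) \<le> mixed a k (Suc m) R x"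
    and x: "\<And>j. 0 < x j"
  shows "C * exp (-1) * (\<Prod>j<m. x j) \<le> mixed a (Suc k) m R x"
proof -
  let ?A = "\<lambda>i j. complex_of_real (a i j)"
  have k: "k \<le> card R" using R by simp
  obtain p where p: "\<And>t. mixed ?A k (Suc m) R ((\<lambda>j. complex_of_real (x j))(m := t)) = poly p t"
    "poly (pderiv p) 0 = mixed ?A (Suc k) m R (\<lambda>j. complex_of_real (x j))"
    using mixed_polynomial[where a = a and z = "\<lambda>j. complex_of_real (x j)" and m = m, OF R(1) k a]
    by blast
  have p_real: "poly p (of_real t) = of_real (mixed a k (Suc m) R (x(m := t)))" for t
  proof -
    have "(\<lambda>j. complex_of_real (x j))(m := of_real t) = (\<lambda>j. of_real ((x(m := t)) j))" by auto
    then show ?thesis using p(1)[of "of_real t"] by (simp only: mixed_of_real)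
  qed
  have pd: "poly (pderiv p) 0 = of_real (mixed a (Suc k) m R x)"
    unfolding p(2) by (simp only: mixed_of_real)
  define X where "X = (\<Prod>j<m. x j)"
  have X: "X > 0" using x by (auto simp: X_def intro: prod_pos)
  have capt: "C * X * t \<le> mixed a k (Suc m) R (x(m := t))" if "t > 0" for t
  proof -
    have "(\<Prod>j<Suc m. (x(m := t)) j) = X * t" by (simp add: X_def)
    then show ?thesis using cap[of "x(m := t)"] x that by (simp add: mult.assoc)
  qed
  show ?thesis
  proof (cases "m = 0")
    \<comment> \<open>Here \<open>p\<close> is homogeneous of degree one, so \<open>p 0 = 0\<close>
      and there is no logarithmic derivative; but the derivative at \<open>0\<close> is simply
      \<open>p 1\<close>.\<close>
    case True
    define K where "K = mixed ?A k (Suc m) R (\<lambda>_. 1)"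
    have "poly p t = poly [:0, K:] t" for t
    proof -
      have "poly p t = mixed ?A k (Suc m) R (\<lambda>j. t * 1)"
        unfolding p(1)[symmetric] using True by (intro mixed_cong) auto
      then show ?thesis
        using mixed_homogeneous[OF R(1) k, of ?A "Suc m" t "\<lambda>_. 1"] R True by (simp add: K_def)
    qed
    then have "p = [:0, K:]" by (simp add: poly_eq_poly_eq_iff[symmetric] fun_eq_iff)
    then have "poly (pderiv p) 0 = poly p 1" by (simp add: pderiv_pCons)
    then have "mixed a (Suc k) m R x = mixed a k (Suc m) R (x(m := 1))"
      using pd p_real[of 1] by (metis of_real_1 of_real_eq_iff)
    then have "C * X \<le> mixed a (Suc k) m R x" using capt[of 1] by simp
    moreover have "C * exp (-1) * X \<le> C * X" using X \<open>0 < C\<close> by simp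
    ultimately show ?thesis by (simp add: X_def)
  next
    case False
    have nonzero: "mixed ?A k (Suc m) R z \<noteq> 0"
      if "\<And>j. j < Suc m \<Longrightarrow> 0 \<le> Re (z j)" "\<exists>j<Suc m. 0 < Re (z j)" for z
      using mixed_stable[OF a R(1) R(2)] that by simp
    have p0: "poly p 0 \<noteq> 0"
      unfolding p(1)[symmetric] using x False by (intro nonzero) (auto simp: less_imp_le intro!: exI[of _ 0])
    have roots: "w \<in> \<real> \<and> Re w < 0" if w: "poly p w = 0" for w
    proof (rule ccontr)
      assume neg: "\<not> (w \<in> \<real> \<and> Re w < 0)"
      \<comment> \<open>Dividing all arguments by \<open>u\<close> sends \<open>w\<close> to
        \<open>u\<close> and each \<open>x j\<close> to \<open>x j / u\<close>. Unless
        \<open>w\<close> is a nonpositive real, these all have positive real part, so stability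
        together with homogeneity excludes the root.\<close>
      define u where "u = csqrt w"
      have "w \<noteq> 0" using w p0 by auto
      have "Re u \<noteq> 0"
      proof
        assume "Re u = 0"
        then have "w = of_real (- (Im u)\<^sup>2)"
          using power2_csqrt[of w] by (simp add: u_def[symmetric] complex_eq_iff power2_eq_square)
        then show False using neg \<open>w \<noteq> 0\<close> by (auto simp: complex_eq_iff complex_is_Real_iff)
      qed
      then have u: "Re u > 0" using csqrt_principal[of w] by (auto simp: u_def)
      define v where "v = 1 / u"
      have "Re v > 0"
        using u unfolding v_def by (auto simp: Re_divide intro!: divide_pos_pos sum_power2_gt_zero_iff[THEN iffD2])
      moreover have "v * w = u" unfolding v_def
        using u power2_csqrt[of w] by (auto simp: u_def[symmetric] power2_eq_square field_simps)
      ultimately have "mixed ?A k (Suc m) R (\<lambda>j. v * ((\<lambda>j. complex_of_real (x j))(m := w)) j) \<noteq> 0"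
        using u x by (intro nonzero) (auto simp: less_imp_le)
      then show False using w p(1)[of w] mixed_homogeneous[OF R(1) k, of ?A "Suc m" v
            "(\<lambda>j. complex_of_real (x j))(m := w)"] by (simp del: fun_upd_apply)
    qed
    obtain s where s: "poly (pderiv p) 0 = poly p 0 * of_real s"
      "\<And>t. 0 \<le> t \<Longrightarrow> \<exists>E. poly p (of_real t) = poly p 0 * of_real E \<and> E \<le> exp (t * s)"
      using poly_le_exp_negative_roots[OF p0 roots] by blast
    define P0 where "P0 = mixed a k (Suc m) R (x(m := 0))"
    have P0: "poly p 0 = of_real P0" using p_real[of 0] by (simp add: P0_def)
    have ds: "mixed a (Suc k) m R x = P0 * s"
      using pd s(1) P0 by (metis of_real_eq_iff of_real_mult)
    have bound: "\<exists>E. mixed a k (Suc m) R (x(m := t)) = P0 * E \<and> E \<le> exp (t * s)" if "0 \<le> t" for t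
      using s(2)[OF that] p_real[of t] P0 by (metis of_real_eq_iff of_real_mult)
    have "P0 \<ge> 0"
      unfolding P0_def using a x by (intro mixed_nonneg) (auto simp: less_imp_le)
    then have "P0 > 0" using p0 P0 by (cases "P0 = 0") auto
    have "0 < P0 * s"
      unfolding ds[symmetric] using False a x R by (intro mixed_pos) auto
    with \<open>P0 > 0\<close> have "s > 0" by (simp add: zero_less_mult_iff)
    \<comment> \<open>\<open>t = 1 / s\<close> minimizes \<open>exp (t * s) / t\<close>; this is the
      origin of the constant \<open>e\<close>.\<close>
    obtain E where E: "mixed a k (Suc m) R (x(m := 1 / s)) = P0 * E" "E \<le> exp (1 / s * s)"
      using bound[of "1 / s"] \<open>s > 0\<close> by auto
    have "C * X * (1 / s) \<le> P0 * E" using capt[of "1 / s"] E(1) \<open>s > 0\<close> by simp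
    also have "\<dots> \<le> P0 * exp 1" using E(2) \<open>P0 > 0\<close> \<open>s > 0\<close> by simp
    finally have "C * X \<le> P0 * s * exp 1" using \<open>s > 0\<close> by (simp add: field_simps)
    then show ?thesis unfolding ds X_def[symmetric] by (simp add: exp_minus field_simps)
  qed
qed

section \<open>The permanent bound for doubly stochastic matrices\<close>

lemma doubly_stochastic_product_bound:
  fixes a :: "nat \<Rightarrow> nat \<Rightarrow> real"
  assumes a: "\<And>i j. 0 \<le> a i j" and row: "\<And>i. i < n \<Longrightarrow> (\<Sum>j<n. a i j) = 1"
    and col: "\<And>j. j < n \<Longrightarrow> (\<Sum>i<n. a i j) = 1" and x: "\<And>j. 0 < x j"
  shows "(\<Prod>j<n. x j) \<le> (\<Prod>i<n. \<Sum>j<n. a i j * x j)"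
proof -
  \<comment> \<open>Weighted AM-GM in each row, from convexity of \<open>exp\<close>; the column
    sums then give every \<open>x j\<close> total exponent one.\<close>
  have "exp (\<Sum>j<n. a i j * ln (x j)) \<le> (\<Sum>j<n. a i j * x j)" if "i < n" for i
  proof -
    have "exp (\<Sum>j<n. a i j *\<^sub>R ln (x j)) \<le> (\<Sum>j<n. a i j * exp (ln (x j)))"
      using row[OF that] a that by (intro convex_on_sum[of _ UNIV]) (auto intro: exp_convex)
    then show ?thesis using x by simp
  qed
  then have "(\<Prod>i<n. exp (\<Sum>j<n. a i j * ln (x j))) \<le> (\<Prod>i<n. \<Sum>j<n. a i j * x j)"
    by (intro prod_mono) auto
  also have "(\<Prod>i<n. exp (\<Sum>j<n. a i j * ln (x j))) = exp (\<Sum>i<n. \<Sum>j<n. a i j * ln (x j))"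
    by (simp add: exp_sum)
  also have "(\<Sum>i<n. \<Sum>j<n. a i j * ln (x j)) = (\<Sum>j<n. (\<Sum>i<n. a i j) * ln (x j))"
    by (subst sum.swap) (simp add: sum_distrib_right)
  also have "\<dots> = (\<Sum>j<n. ln (x j))" using col by simp
  also have "exp \<dots> = (\<Prod>j<n. x j)" using x by (simp add: exp_sum)
  finally show ?thesis .
qed

text \<open>Starting from capacity at least \<open>1\<close>, each of \<open>k\<close> capacity
  steps loses a factor \<open>e\<close>. At \<open>k = n\<close> no variable remains and the value
  is the permanent.\<close>

lemma mixed_doubly_stochastic_pos:
  fixes a :: "nat \<Rightarrow> nat \<Rightarrow> real"
  assumes a: "\<And>i j. 0 < a i j" and row: "\<And>i. i < n \<Longrightarrow> (\<Sum>j<n. a i j) = 1"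
    and col: "\<And>j. j < n \<Longrightarrow> (\<Sum>i<n. a i j) = 1"
  shows "k \<le> n \<Longrightarrow> (\<And>j. 0 < x j) \<Longrightarrow> exp (- real k) * (\<Prod>j<n - k. x j) \<le> mixed a k (n - k) {..<n} x"
proof (induction k arbitrary: x)
  case 0
  then show ?case
    using doubly_stochastic_product_bound[of a n x] a row col by (simp add: less_imp_le)
next
  case (Suc k)
  have "n - k = Suc (n - Suc k)" using Suc by simp
  then have "exp (- real k) * exp (- 1) * (\<Prod>j<n - Suc k. x j) \<le> mixed a (Suc k) (n - Suc k) {..<n} x"
    using Suc a by (intro mixed_capacity_step) (auto simp del: mixed.simps prod.lessThan_Suc)
  moreover have "exp (- real (Suc k)) = exp (- real k) * exp (- 1)"
    by (simp flip: exp_add)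
  ultimately show ?case by (simp only:)
qed

lemma tendsto_mixed:
  fixes f :: "'b \<Rightarrow> nat \<Rightarrow> nat \<Rightarrow> real"
  assumes "\<And>i j. ((\<lambda>e. f e i j) \<longlongrightarrow> g i j) F"
  shows "((\<lambda>e. mixed (f e) k m R z) \<longlongrightarrow> mixed g k m R z) F"
  using assms by (induction k arbitrary: R) (auto intro!: tendsto_intros)

lemma mixed_doubly_stochastic:
  fixes a :: "nat \<Rightarrow> nat \<Rightarrow> real"
  assumes a: "\<And>i j. 0 \<le> a i j" and row: "\<And>i. i < n \<Longrightarrow> (\<Sum>j<n. a i j) = 1"
    and col: "\<And>j. j < n \<Longrightarrow> (\<Sum>i<n. a i j) = 1" and "0 < n"
  shows "exp (- real n) \<le> mixed a n 0 {..<n} x"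
proof -
  \<comment> \<open>Mixing with the uniform matrix preserves row and column sums and makes all
    entries positive, as stability demands; the bound survives the limit \<open>e\<close> to
    \<open>0\<close>.\<close>
  define b where "b = (\<lambda>e i j. (1 - e) * a i j + e / real n)"
  have "((\<lambda>e. mixed (b e) n 0 {..<n} x) \<longlongrightarrow> mixed (b 0) n 0 {..<n} x) (at_right 0)"
    unfolding b_def using \<open>0 < n\<close> by (intro tendsto_mixed) (auto intro!: tendsto_eq_intros)
  moreover have "b 0 = a" by (auto simp: b_def)
  moreover have "eventually (\<lambda>e. exp (- real n) \<le> mixed (b e) n 0 {..<n} x) (at_right 0)"
  proof -
    have "exp (- real n) \<le> mixed (b e) n 0 {..<n} x" if e: "0 < e" "e < 1" for e
    proof -
      have pos: "0 < b e i j" for i j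
        unfolding b_def using a e \<open>0 < n\<close> by (intro add_nonneg_pos) auto
      have "exp (- real n) * (\<Prod>j<n - n. (\<lambda>_. 1::real) j) \<le> mixed (b e) n (n - n) {..<n} (\<lambda>_. 1)"
        using row col \<open>0 < n\<close> pos
        by (intro mixed_doubly_stochastic_pos)
          (auto simp: b_def sum.distrib sum_distrib_left[symmetric] simp del: mixed.simps)
      moreover have "mixed (b e) n 0 {..<n} (\<lambda>_. 1) = mixed (b e) n 0 {..<n} x"
        by (intro mixed_cong) simp
      ultimately show ?thesis by simp
    qed
    then show ?thesis by (auto simp: eventually_at_right_field intro: exI[of _ 1])
  qed
  ultimately show ?thesis
    using tendsto_lowerbound[of "\<lambda>e. mixed (b e) n 0 {..<n} x" "mixed (b 0) n 0 {..<n} x" "at_right 0" "exp (- real n)"]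
    by simp
qed

section \<open>Counting perfect matchings\<close>

definition matchings :: "nat \<Rightarrow> nat set \<Rightarrow> (nat \<times> nat) set \<Rightarrow> (nat \<Rightarrow> nat) set" where
  "matchings k R G = {f \<in> {..<k} \<rightarrow>\<^sub>E R. bij_betw f {..<k} R \<and> (\<forall>b<k. (b, f b) \<in> G)}"

lemma finite_matchings: "finite R \<Longrightarrow> finite (matchings k R G)"
  unfolding matchings_def by (rule finite_subset[of _ "{..<k} \<rightarrow>\<^sub>E R"]) (auto intro: finite_PiE)

lemma matchings_Suc:
  "matchings (Suc k) R G = (\<Union>c\<in>{c \<in> R. (k, c) \<in> G}. (\<lambda>f. f(k := c)) ` matchings k (R - {c}) G)"
proof (intro set_eqI iffI)
  fix f assume f: "f \<in> matchings (Suc k) R G"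
  define c where "c = f k"
  have bij: "bij_betw f {..<Suc k} R" using f by (simp add: matchings_def)
  have c: "c \<in> R" "(k, c) \<in> G" using f by (auto simp: matchings_def c_def)
  have "bij_betw f {..<k} (R - {c})"
    using bij unfolding bij_betw_def c_def lessThan_Suc by (auto simp: image_iff) (metis lessThan_iff)
  then have "bij_betw (restrict f {..<k}) {..<k} (R - {c})"
    by (subst bij_betw_cong[of _ _ f]) auto
  moreover have "f = (restrict f {..<k})(k := c)"
    using f by (auto simp: matchings_def c_def fun_eq_iff PiE_def extensional_def)
  moreover have "restrict f {..<k} \<in> {..<k} \<rightarrow>\<^sub>E R - {c}"
    using \<open>bij_betw f {..<k} (R - {c})\<close> by (auto simp: bij_betw_def)
  moreover have "\<forall>b<k. (b, restrict f {..<k} b) \<in> G"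
    using f by (auto simp: matchings_def)
  ultimately have "restrict f {..<k} \<in> matchings k (R - {c}) G" "f = (restrict f {..<k})(k := c)"
    by (simp_all add: matchings_def)
  with c show "f \<in> (\<Union>c\<in>{c \<in> R. (k, c) \<in> G}. (\<lambda>f. f(k := c)) ` matchings k (R - {c}) G)"
    by blast
next
  fix f assume "f \<in> (\<Union>c\<in>{c \<in> R. (k, c) \<in> G}. (\<lambda>f. f(k := c)) ` matchings k (R - {c}) G)"
  then obtain c g where c: "c \<in> R" "(k, c) \<in> G" and g: "g \<in> matchings k (R - {c}) G" and f: "f = g(k := c)"
    by blast
  have "bij_betw g {..<k} (R - {c})" using g by (simp add: matchings_def)
  then have "bij_betw f {..<k} (R - {c})" unfolding f by (subst bij_betw_cong[of _ _ g]) auto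
  moreover have "bij_betw f {k} {c}" by (simp add: f bij_betw_def)
  ultimately have "bij_betw f ({..<k} \<union> {k}) (R - {c} \<union> {c})"
    by (rule bij_betw_combine) auto
  moreover have "{..<k} \<union> {k} = {..<Suc k}" "R - {c} \<union> {c} = R" using c by auto
  ultimately have "bij_betw f {..<Suc k} R" by simp
  then show "f \<in> matchings (Suc k) R G"
    using c g by (auto simp: matchings_def f PiE_def extensional_def Pi_def less_Suc_eq)
qed

text \<open>\<open>matchings_Suc\<close> is the expansion of the permanent along column
  \<open>k\<close>. The argument \<open>z\<close> is arbitrary because no variables are
  left.\<close>

lemma card_matchings:
  assumes "finite R" "card R = k"
  shows "real (card (matchings k R G)) = mixed (\<lambda>c b. if (b, c) \<in> G then 1 else 0) k 0 R z"
  using assms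
proof (induction k arbitrary: R)
  case 0
  then have "matchings 0 R G = {\<lambda>_. undefined}" by (auto simp: matchings_def bij_betw_def)
  with 0 show ?case by simp
next
  case (Suc k)
  let ?a = "\<lambda>c b. if (b, c) \<in> G then 1 else (0::real)"
  have inj: "inj_on (\<lambda>f. f(k := c)) (matchings k (R - {c}) G)" for c
  proof (rule inj_onI)
    fix f g assume fg: "f \<in> matchings k (R - {c}) G" "g \<in> matchings k (R - {c}) G" "f(k := c) = g(k := c)"
    then have "f k = g k" by (auto simp: matchings_def PiE_def extensional_def)
    with fg(3) show "f = g" by (metis fun_upd_triv fun_upd_upd)
  qed
  have "card (matchings (Suc k) R G) = (\<Sum>c\<in>{c \<in> R. (k, c) \<in> G}. card ((\<lambda>f. f(k := c)) ` matchings k (R - {c}) G))"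
    unfolding matchings_Suc using Suc.prems
    by (intro card_UN_disjoint) (auto simp: finite_matchings, metis fun_upd_same)
  also have "\<dots> = (\<Sum>c\<in>{c \<in> R. (k, c) \<in> G}. card (matchings k (R - {c}) G))"
    by (simp add: card_image inj)
  finally have "real (card (matchings (Suc k) R G)) = (\<Sum>c\<in>{c \<in> R. (k, c) \<in> G}. real (card (matchings k (R - {c}) G)))"
    by simp
  also have "\<dots> = (\<Sum>c\<in>{c \<in> R. (k, c) \<in> G}. mixed ?a k 0 (R - {c}) z)"
    using Suc by (intro sum.cong) auto
  also have "\<dots> = (\<Sum>c\<in>R. ?a c k * mixed ?a k 0 (R - {c}) z)"
    using Suc.prems by (intro sum.mono_neutral_cong_left) auto
  finally show ?case by simp
qed

definition regular :: "nat \<Rightarrow> nat \<Rightarrow> (nat \<times> nat) set \<Rightarrow> bool" where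
  "regular n d G \<longleftrightarrow> G \<subseteq> {..<n} \<times> {..<n} \<and> (\<forall>b<n. card (G `` {b}) = d) \<and> (\<forall>c<n. card (G\<inverse> `` {c}) = d)"

text \<open>The adjacency matrix divided by \<open>d\<close> is doubly stochastic, so its permanent
  is at least \<open>exp (- n)\<close>.\<close>

lemma card_matchings_regular:
  assumes G: "regular n d G" and "0 < d"
  shows "(real d / exp 1) ^ n \<le> real (card (matchings n {..<n} G))"
proof (cases "n = 0")
  case True
  then have "matchings n {..<n} G = {\<lambda>_. undefined}" by (auto simp: matchings_def bij_betw_def)
  with True show ?thesis by simp
next
  case False
  define a where "a = (\<lambda>c b. if (b, c) \<in> G then 1 else (0::real))"
  have sub: "G `` {b} \<subseteq> {..<n}" "G\<inverse> `` {b} \<subseteq> {..<n}" for b using G by (auto simp: regular_def)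
  have row: "(\<Sum>b<n. a c b) = real d" if "c < n" for c
  proof -
    have "{b \<in> {..<n}. (b, c) \<in> G} = G\<inverse> `` {c}" using sub by auto
    then show ?thesis using G that by (simp add: a_def sum.If_cases regular_def Int_def)
  qed
  have col: "(\<Sum>c<n. a c b) = real d" if "b < n" for b
  proof -
    have "{c \<in> {..<n}. (b, c) \<in> G} = G `` {b}" using sub by auto
    then show ?thesis using G that by (simp add: a_def sum.If_cases regular_def Int_def)
  qed
  have "exp (- real n) \<le> mixed (\<lambda>c b. inverse (real d) * a c b) n 0 {..<n} (\<lambda>_. 0)"
    using False row col \<open>0 < d\<close>
    by (intro mixed_doubly_stochastic) (auto simp: sum_distrib_left[symmetric] a_def)
  also have "\<dots> = inverse (real d) ^ n * mixed a n 0 {..<n} (\<lambda>_. 0)"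
    by (rule mixed_scale) auto
  also have "mixed a n 0 {..<n} (\<lambda>_. 0) = real (card (matchings n {..<n} G))"
    unfolding a_def by (rule card_matchings[symmetric]) auto
  finally have "exp (- real n) * real d ^ n \<le> real (card (matchings n {..<n} G))"
    using \<open>0 < d\<close> by (simp add: field_simps)
  moreover have "exp (- real n) * real d ^ n = (real d / exp 1) ^ n"
    using exp_of_nat_mult[of n "1::real"] by (simp add: power_divide exp_minus divide_inverse power_mult_distrib power_inverse)
  ultimately show ?thesis by simp
qed

subsection \<open>One-factorizations of regular bipartite graphs\<close>

text \<open>Lists rather than sets: position \<open>v\<close> names the row that will receive the
  matching, so reorderings count as different choices.\<close>

primrec factorizations :: "nat \<Rightarrow> nat \<Rightarrow> (nat \<times> nat) set \<Rightarrow> (nat \<Rightarrow> nat) list set" where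
  "factorizations n 0 G = {[]}"
| "factorizations n (Suc r) G =
     (\<Union>f\<in>matchings n {..<n} G. (#) f ` factorizations n r (G - (\<lambda>b. (b, f b)) ` {..<n}))"

lemma finite_regular:
  assumes "regular n d G"
  shows "finite (G `` {b})" "finite (G\<inverse> `` {b})"
proof -
  have "G `` {b} \<subseteq> {..<n}" "G\<inverse> `` {b} \<subseteq> {..<n}"
    using assms by (auto simp: regular_def)
  then show "finite (G `` {b})" "finite (G\<inverse> `` {b})"
    by (meson finite_lessThan finite_subset)+
qed

lemma regular_remove_matching:
  assumes G: "regular n (Suc d) G" and f: "f \<in> matchings n {..<n} G"
  shows "regular n d (G - (\<lambda>b. (b, f b)) ` {..<n})" (is "regular n d ?H")
proof -
  have inj: "inj_on f {..<n}" and im: "f ` {..<n} = {..<n}" and fG: "\<And>b. b < n \<Longrightarrow> (b, f b) \<in> G"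
    using f by (auto simp: matchings_def bij_betw_def)
  have "card (?H `` {b}) = d" if "b < n" for b
  proof -
    have eq: "?H `` {b} = G `` {b} - {f b}" using that by auto
    have "card (G `` {b}) = Suc d" using G that by (simp add: regular_def)
    moreover have "f b \<in> G `` {b}" using fG[OF that] by simp
    ultimately show ?thesis unfolding eq by (simp add: card_Diff_singleton)
  qed
  moreover have "card (?H\<inverse> `` {c}) = d" if c: "c < n" for c
  proof -
    have "c \<in> f ` {..<n}" unfolding im using c by simp
    then obtain b where b: "b < n" "c = f b" by auto
    have "b' = b" if "b' < n" "f b' = f b" for b'
      using inj_onD[OF inj that(2)] b that by simp
    then have eq: "?H\<inverse> `` {c} = G\<inverse> `` {c} - {b}" using b by auto
    have "card (G\<inverse> `` {c}) = Suc d" using G c by (simp add: regular_def)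
    moreover have "b \<in> G\<inverse> `` {c}" using fG[OF b(1)] b by simp
    ultimately show ?thesis unfolding eq by (simp add: card_Diff_singleton)
  qed
  ultimately show ?thesis using G unfolding regular_def by blast
qed

lemma finite_factorizations: "finite (factorizations n r G)"
  by (induction r arbitrary: G) (auto simp: finite_matchings)

text \<open>Removing a perfect matching lowers the degree by one, so the bounds
  \<open>(d / e) ^ n\<close> for \<open>d = r, ..., 1\<close> multiply up.\<close>

lemma card_factorizations:
  assumes "regular n r G"
  shows "(fact r / exp 1 ^ r) ^ n \<le> real (card (factorizations n r G))"
  using assms
proof (induction r arbitrary: G)
  case (Suc r)
  let ?H = "\<lambda>f. G - (\<lambda>b. (b, f b)) ` {..<n}"
  have "card (factorizations n (Suc r) G) =
      (\<Sum>f\<in>matchings n {..<n} G. card ((#) f ` factorizations n r (?H f)))"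
    unfolding factorizations.simps
    by (intro card_UN_disjoint) (auto simp: finite_matchings finite_factorizations)
  also have "\<dots> = (\<Sum>f\<in>matchings n {..<n} G. card (factorizations n r (?H f)))"
    by (simp add: card_image)
  finally have "real (card (factorizations n (Suc r) G)) =
      (\<Sum>f\<in>matchings n {..<n} G. real (card (factorizations n r (?H f))))" by simp
  also have "\<dots> \<ge> (\<Sum>f\<in>matchings n {..<n} G. (fact r / exp 1 ^ r) ^ n)"
    by (intro sum_mono Suc.IH regular_remove_matching[OF Suc.prems])
  also have "(\<Sum>f\<in>matchings n {..<n} G. (fact r / exp 1 ^ r) ^ n) =
      real (card (matchings n {..<n} G)) * (fact r / exp 1 ^ r) ^ n" by simp
  also have "\<dots> \<ge> (real (Suc r) / exp 1) ^ n * (fact r / exp 1 ^ r) ^ n"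
    using card_matchings_regular[OF Suc.prems] by (intro mult_right_mono) auto
  also have "(real (Suc r) / exp 1) ^ n * (fact r / exp 1 ^ r) ^ n = (fact (Suc r) / exp 1 ^ Suc r) ^ n"
    by (simp only: power_mult_distrib[symmetric] times_divide_times_eq fact_Suc power_Suc)
  finally show ?case .
qed simp

lemma power_le_fact: "(real r / exp 1) ^ r \<le> fact r"
proof -
  have "(\<Sum>k\<in>{r}. real r ^ k /\<^sub>R fact k) \<le> suminf (\<lambda>k. real r ^ k /\<^sub>R fact k)"
    by (intro sum_le_suminf summable_exp_generic) auto
  then have "real r ^ r / fact r \<le> exp (real r)"
    by (simp add: exp_def divide_inverse mult.commute)
  then have "real r ^ r \<le> exp (real r) * fact r" by (simp add: pos_divide_le_eq)
  then show ?thesis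
    using exp_of_nat_mult[of r "1::real"] by (simp add: power_divide pos_divide_le_eq mult.commute)
qed

text \<open>One factor \<open>e\<close> comes from the matching bound, the other from estimating
  \<open>r!\<close>.\<close>

lemma card_factorizations_ge:
  assumes "regular n r G"
  shows "(real r / exp 2) ^ (r * n) \<le> real (card (factorizations n r G))"
proof -
  have "(real r / exp 2) ^ (r * n) = ((real r / exp 1) ^ r / exp 1 ^ r) ^ n"
  proof -
    have "exp 2 = exp 1 * exp (1::real)" using exp_add[of 1 "1::real"] by simp
    then have "real r / exp 2 = real r / exp 1 / exp 1" by simp
    then show ?thesis by (simp only: power_mult power_divide)
  qed
  also have "\<dots> \<le> (fact r / exp 1 ^ r) ^ n"
    using power_le_fact by (intro power_mono divide_right_mono) auto
  finally show ?thesis using card_factorizations[OF assms] by linarith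
qed

lemma factorizations_props:
  assumes "regular n r G" "gs \<in> factorizations n r G"
  shows "length gs = r" "\<And>v. v < r \<Longrightarrow> gs ! v \<in> matchings n {..<n} G"
    "\<And>b c. (b, c) \<in> G \<Longrightarrow> \<exists>!v. v < r \<and> (gs ! v) b = c"
proof -
  have "length gs = r \<and> (\<forall>v<r. gs ! v \<in> matchings n {..<n} G) \<and>
      (\<forall>b c. (b, c) \<in> G \<longrightarrow> (\<exists>!v. v < r \<and> (gs ! v) b = c))"
    using assms
  proof (induction r arbitrary: G gs)
    case 0
    have "(b, c) \<notin> G" for b c
    proof
      assume bc: "(b, c) \<in> G"
      then have "b < n" "finite (G `` {b})"
        using 0 finite_regular[of n 0 G b] by (auto simp: regular_def)
      moreover have "card (G `` {b}) = 0" using 0 \<open>b < n\<close> by (simp add: regular_def)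
      ultimately have "G `` {b} = {}" by simp
      then show False using bc by auto
    qed
    then show ?case using 0 by simp
  next
    case (Suc r)
    obtain f hs where f: "f \<in> matchings n {..<n} G" and gs: "gs = f # hs"
      and hs: "hs \<in> factorizations n r (G - (\<lambda>b. (b, f b)) ` {..<n})"
      using Suc.prems(2) by auto
    let ?H = "G - (\<lambda>b. (b, f b)) ` {..<n}"
    note IH = Suc.IH[OF regular_remove_matching[OF Suc.prems(1) f] hs]
    have len: "length hs = r" and hm: "\<And>w. w < r \<Longrightarrow> hs ! w \<in> matchings n {..<n} ?H"
      and hu: "\<And>b c. (b, c) \<in> ?H \<Longrightarrow> \<exists>!w. w < r \<and> (hs ! w) b = c"
      using IH by simp_all
    have m: "gs ! v \<in> matchings n {..<n} G" if "v < Suc r" for v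
    proof (cases v)
      case (Suc w)
      then have "hs ! w \<in> matchings n {..<n} ?H" using hm that by simp
      then show ?thesis using Suc by (auto simp: gs matchings_def)
    qed (use f in \<open>simp add: gs\<close>)
    have "\<exists>!v. v < Suc r \<and> (gs ! v) b = c" if bc: "(b, c) \<in> G" for b c
    proof (cases "c = f b")
      case True
      have "v = 0" if v: "v < Suc r" "(gs ! v) b = c" for v
      proof (rule ccontr)
        assume "v \<noteq> 0"
        then obtain w where w: "v = Suc w" by (cases v) auto
        have "hs ! w \<in> matchings n {..<n} ?H" using hm v w by simp
        moreover have "(hs ! w) b = f b" using v w True by (simp add: gs)
        moreover have "b < n" using bc Suc.prems(1) by (auto simp: regular_def)
        ultimately show False by (auto simp: matchings_def)
      qed
      then show ?thesis using True by (intro ex1I[of _ 0]) (auto simp: gs)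
    next
      case False
      then have "(b, c) \<in> ?H" using bc by auto
      from hu[OF this] obtain w where w: "w < r" "(hs ! w) b = c"
        and uniq: "\<forall>w'. w' < r \<and> (hs ! w') b = c \<longrightarrow> w' = w"
        by (elim ex1E) blast
      show ?thesis
      proof (rule ex1I[of _ "Suc w"])
        show "Suc w < Suc r \<and> (gs ! Suc w) b = c" using w by (simp add: gs)
        fix v assume v: "v < Suc r \<and> (gs ! v) b = c"
        then obtain w' where "v = Suc w'" using False by (cases v) (auto simp: gs)
        then show "v = Suc w" using v uniq by (simp add: gs)
      qed
    qed
    moreover have "length gs = Suc r" using len by (simp add: gs)
    ultimately show ?case using m by simp
  qed
  then show "length gs = r" "\<And>v. v < r \<Longrightarrow> gs ! v \<in> matchings n {..<n} G"
    "\<And>b c. (b, c) \<in> G \<Longrightarrow> \<exists>!v. v < r \<and> (gs ! v) b = c" by simp_all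
qed

subsection \<open>Vertices of the polytope\<close>

lemma lookup_scaleR: "Poly_Mapping.lookup (c *\<^sub>R M) p = c * Poly_Mapping.lookup M p"
  for M :: "'a \<Rightarrow>\<^sub>0 real"
proof -
  have "finite {i. c * Poly_Mapping.lookup M i \<noteq> 0}"
    by (rule finite_subset[OF _ finite_keys[of M]]) (auto simp: in_keys_iff)
  then show ?thesis by (simp add: scaleR_poly_mapping_def Abs_poly_mapping_inverse)
qed

lemma tristochastic_outside:
  assumes "tristochastic n M" "\<not> (i < n \<and> j < n \<and> k < n)"
  shows "entry M i j k = 0"
proof (rule ccontr)
  assume "entry M i j k \<noteq> 0"
  then have "(i, j, k) \<in> Poly_Mapping.keys M" by (simp add: in_keys_iff)
  then show False using assms by (auto simp: tristochastic_def arrays_def)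
qed

lemma tristochastic_nonneg:
  assumes "tristochastic n M"
  shows "0 \<le> Poly_Mapping.lookup M p"
proof -
  obtain i j k where p: "p = (i, j, k)" by (cases p)
  show ?thesis
    using assms tristochastic_outside[OF assms, of i j k] unfolding p
    by (cases "i < n \<and> j < n \<and> k < n") (auto simp: tristochastic_def)
qed

lemma tristochastic_le_1:
  assumes "tristochastic n M"
  shows "Poly_Mapping.lookup M p \<le> 1"
proof -
  obtain i j k where p: "p = (i, j, k)" by (cases p)
  show ?thesis
  proof (cases "i < n \<and> j < n \<and> k < n")
    case True
    then have "entry M i j k \<le> (\<Sum>k<n. entry M i j k)"
      using tristochastic_nonneg[OF assms] by (intro member_le_sum) auto
    then show ?thesis using True assms p by (simp add: tristochastic_def)
  qed (use tristochastic_outside[OF assms] p in auto)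
qed

text \<open>If \<open>M\<close> lies strictly between \<open>A\<close> and \<open>B\<close>,
  nonnegativity forces both to vanish wherever \<open>M\<close> does, so \<open>A - B\<close>
  satisfies the premises of \<open>kernel\<close>.\<close>

lemma vertexI:
  assumes M: "tristochastic n M"
    and kernel: "\<And>x. (\<And>i j k. entry M i j k = 0 \<Longrightarrow> x i j k = (0::real)) \<Longrightarrow>
      (\<And>j k. j < n \<Longrightarrow> k < n \<Longrightarrow> (\<Sum>i<n. x i j k) = 0) \<Longrightarrow>
      (\<And>i k. i < n \<Longrightarrow> k < n \<Longrightarrow> (\<Sum>j<n. x i j k) = 0) \<Longrightarrow>
      (\<And>i j. i < n \<Longrightarrow> j < n \<Longrightarrow> (\<Sum>k<n. x i j k) = 0) \<Longrightarrow>
      (\<And>i j k. i < n \<Longrightarrow> j < n \<Longrightarrow> k < n \<Longrightarrow> x i j k = 0)"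
  shows "M \<in> vertices (tristochastic_polytope n)"
proof -
  have "M \<notin> open_segment A B" if A: "tristochastic n A" and B: "tristochastic n B" for A B
  proof
    assume "M \<in> open_segment A B"
    then obtain u where u: "A \<noteq> B" "0 < u" "u < 1" "M = (1 - u) *\<^sub>R A + u *\<^sub>R B"
      by (auto simp: in_segment)
    define x where "x i j k = entry A i j k - entry B i j k" for i j k
    have "x i j k = 0" if "entry M i j k = 0" for i j k
    proof -
      have "(1 - u) * entry A i j k + u * entry B i j k = 0"
        using that unfolding u(4) by (simp add: lookup_add lookup_scaleR)
      moreover have "0 \<le> (1 - u) * entry A i j k" "0 \<le> u * entry B i j k"
        using u tristochastic_nonneg[OF A] tristochastic_nonneg[OF B] by auto
      ultimately have "(1 - u) * entry A i j k = 0" "u * entry B i j k = 0" by linarith+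
      then show ?thesis using u by (simp add: x_def)
    qed
    moreover have "(\<Sum>i<n. x i j k) = 0" if "j < n" "k < n" for j k
      using A B that by (simp add: x_def sum_subtractf tristochastic_def)
    moreover have "(\<Sum>j<n. x i j k) = 0" if "i < n" "k < n" for i k
      using A B that by (simp add: x_def sum_subtractf tristochastic_def)
    moreover have "(\<Sum>k<n. x i j k) = 0" if "i < n" "j < n" for i j
      using A B that by (simp add: x_def sum_subtractf tristochastic_def)
    ultimately have "x i j k = 0" if "i < n" "j < n" "k < n" for i j k
      using kernel[of x i j k] that by blast
    then have "entry A i j k = entry B i j k" for i j k
      using tristochastic_outside[OF A, of i j k] tristochastic_outside[OF B, of i j k]
      by (cases "i < n \<and> j < n \<and> k < n") (auto simp: x_def)
    then have "A = B" by (intro poly_mapping_eqI) auto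
    then show False using u by simp
  qed
  then show ?thesis
    using M by (auto simp: vertices_def extreme_point_of_def tristochastic_polytope_def)
qed

section \<open>Finiteness of the vertex set\<close>

lemma vertices_eq_if_keys_eq:
  assumes v: "v \<in> vertices (tristochastic_polytope n)" and w: "tristochastic n w"
    and keys: "Poly_Mapping.keys w = Poly_Mapping.keys v"
  shows "v = w"
proof (rule ccontr)
  assume "v \<noteq> w"
  have vt: "tristochastic n v" and ext: "\<And>a b. tristochastic n a \<Longrightarrow> tristochastic n b \<Longrightarrow> v \<notin> open_segment a b"
    using v by (auto simp: vertices_def extreme_point_of_def tristochastic_polytope_def)
  \<comment> \<open>Moving from \<open>v\<close> away from \<open>w\<close> by
    \<open>t * (v - w)\<close> stays nonnegative: entries of \<open>w\<close> are at most
    \<open>1\<close>, those of \<open>v\<close> on its support at least \<open>t\<close>. The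
    inserted \<open>1\<close> covers an empty support. Then \<open>v\<close> is interior to a
    segment ending in \<open>w\<close>.\<close>
  define t where "t = Min (insert 1 (Poly_Mapping.lookup v ` Poly_Mapping.keys v))"
  have t_le: "t \<le> Poly_Mapping.lookup v p" if "p \<in> Poly_Mapping.keys v" for p
    using that by (simp add: t_def)
  have "0 < Poly_Mapping.lookup v p" if "p \<in> Poly_Mapping.keys v" for p
    using that tristochastic_nonneg[OF vt, of p] by (simp add: in_keys_iff)
  then have t: "0 < t" by (auto simp: t_def)
  define a where "a = (1 + t) *\<^sub>R v - t *\<^sub>R w"
  have la: "Poly_Mapping.lookup a p = (1 + t) * Poly_Mapping.lookup v p - t * Poly_Mapping.lookup w p" for p
    by (simp add: a_def lookup_minus lookup_scaleR)
  have nonneg: "0 \<le> Poly_Mapping.lookup a p" for p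
  proof (cases "p \<in> Poly_Mapping.keys v")
    case True
    have "t * Poly_Mapping.lookup w p \<le> t * 1"
      using t tristochastic_le_1[OF w] by (intro mult_left_mono) auto
    also have "\<dots> \<le> Poly_Mapping.lookup v p" using t_le[OF True] by simp
    also have "\<dots> \<le> (1 + t) * Poly_Mapping.lookup v p"
      using t tristochastic_nonneg[OF vt, of p] by (simp add: algebra_simps)
    finally show ?thesis by (simp add: la)
  next
    case False
    then have "Poly_Mapping.lookup v p = 0" "Poly_Mapping.lookup w p = 0"
      using keys by (auto simp: in_keys_iff)
    then show ?thesis by (simp add: la)
  qed
  have "Poly_Mapping.keys a \<subseteq> Poly_Mapping.keys v"
  proof
    fix p assume "p \<in> Poly_Mapping.keys a"
    then have "Poly_Mapping.lookup v p \<noteq> 0 \<or> Poly_Mapping.lookup w p \<noteq> 0"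
      by (auto simp: in_keys_iff la)
    then show "p \<in> Poly_Mapping.keys v" by (metis keys in_keys_iff)
  qed
  then have arr: "a \<in> arrays n" using vt by (auto simp: arrays_def tristochastic_def)
  have S: "(\<Sum>x<n. Poly_Mapping.lookup a (f x)) = 1"
    if "(\<Sum>x<n. Poly_Mapping.lookup v (f x)) = 1" "(\<Sum>x<n. Poly_Mapping.lookup w (f x)) = 1"
    for f :: "nat \<Rightarrow> nat \<times> nat \<times> nat"
    unfolding la sum_subtractf sum_distrib_left[symmetric] using that by simp
  note arr
  moreover have "(\<Sum>i<n. entry a i j k) = 1" if "j < n" "k < n" for j k
    using S[of "\<lambda>i. (i, j, k)"] vt w that by (simp add: tristochastic_def)
  moreover have "(\<Sum>j<n. entry a i j k) = 1" if "i < n" "k < n" for i k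
    using S[of "\<lambda>j. (i, j, k)"] vt w that by (simp add: tristochastic_def)
  moreover have "(\<Sum>k<n. entry a i j k) = 1" if "i < n" "j < n" for i j
    using S[of "\<lambda>k. (i, j, k)"] vt w that by (simp add: tristochastic_def)
  ultimately have "tristochastic n a"
    unfolding tristochastic_def using nonneg by blast
  moreover have "v = (1 - t / (1 + t)) *\<^sub>R a + (t / (1 + t)) *\<^sub>R w"
  proof (rule poly_mapping_eqI)
    fix p
    have "(1 - t / (1 + t)) * ((1 + t) * Poly_Mapping.lookup v p - t * Poly_Mapping.lookup w p) +
        t / (1 + t) * Poly_Mapping.lookup w p = Poly_Mapping.lookup v p"
      using t by (simp add: divide_simps)
    then show "Poly_Mapping.lookup v p = Poly_Mapping.lookup ((1 - t / (1 + t)) *\<^sub>R a + (t / (1 + t)) *\<^sub>R w) p"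
      by (simp add: lookup_add lookup_scaleR la)
  qed
  moreover have "a \<noteq> w"
  proof
    assume "a = w"
    then have "(1 + t) * Poly_Mapping.lookup v p = (1 + t) * Poly_Mapping.lookup w p" for p
      using la[of p] by (simp add: algebra_simps)
    then have "v = w" using t by (intro poly_mapping_eqI) simp
    then show False using \<open>v \<noteq> w\<close> by simp
  qed
  ultimately have "v \<in> open_segment a w"
    using t by (auto simp: in_segment intro!: exI[of _ "t / (1 + t)"])
  then show False using ext[OF \<open>tristochastic n a\<close> w] by simp
qed

text \<open>A vertex is determined by its support. Finiteness matters because \<open>card\<close> is
  \<open>0\<close> on infinite sets, so exhibiting many vertices would not bound it.\<close>

lemma finite_vertices: "finite (vertices (tristochastic_polytope n))"
proof (rule finite_imageD)
  show "finite (Poly_Mapping.keys ` vertices (tristochastic_polytope n))"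
    by (rule finite_subset[of _ "Pow ({..<n} \<times> {..<n} \<times> {..<n})"])
      (auto simp: vertices_def extreme_point_of_def tristochastic_polytope_def tristochastic_def arrays_def)
  show "inj_on Poly_Mapping.keys (vertices (tristochastic_polytope n))"
    by (rule inj_onI, rule vertices_eq_if_keys_eq)
      (auto simp: vertices_def extreme_point_of_def tristochastic_polytope_def)
qed

lemma sum_div_mod:
  fixes f :: "nat \<Rightarrow> nat \<Rightarrow> 'a::comm_monoid_add"
  assumes "0 < r"
  shows "(\<Sum>i<q * r. f (i div r) (i mod r)) = (\<Sum>g<q. \<Sum>v<r. f g v)"
proof -
  have lt: "g * r + v < q * r" if "g < q" "v < r" for g v
  proof -
    have "g * r + v < Suc g * r" using that by simp
    also have "\<dots> \<le> q * r" using that by (intro mult_le_mono1) simp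
    finally show ?thesis .
  qed
  show ?thesis
    unfolding sum.cartesian_product
    by (rule sum.reindex_bij_witness[of _ "\<lambda>(g, v). g * r + v" "\<lambda>i. (i div r, i mod r)"])
      (use assms lt in \<open>auto simp: less_mult_imp_div_less\<close>)
qed

subsection \<open>Classes of (column, symbol) pairs\<close>

lemma add_mod_eq_if:
  fixes b d n :: nat
  assumes "b < n" "d \<le> n"
  shows "(b + d) mod n = (if b + d < n then b + d else b + d - n)"
  using assms by (auto simp: mod_if)

lemma add_mod_inj:
  fixes b d n :: nat
  assumes "b < n" "d < n" "d' < n" "(b + d) mod n = (b + d') mod n"
  shows "d = d'"
  using assms by (auto simp: add_mod_eq_if split: if_splits)

lemma add_mod_shift:
  fixes b c d n :: nat
  assumes "b < n" "c < n" "d < n"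
  shows "c = (b + d) mod n \<longleftrightarrow> b = (c + (n - d)) mod n"
proof -
  have "(c + (n - d)) mod n = (if d \<le> c then c - d else c + n - d)"
  proof (cases "d \<le> c")
    case True
    then have eq: "c + (n - d) = c - d + n" using assms by simp
    show ?thesis unfolding eq mod_add_self2 using True assms by simp
  qed (use assms in simp)
  then show ?thesis using assms by (auto simp: add_mod_eq_if)
qed

lemma add_mod_obtain:
  fixes b c n :: nat
  assumes "b < n" "c < n"
  obtains d where "d < n" "c = (b + d) mod n"
proof (cases "b \<le> c")
  case True
  then show ?thesis using assms that[of "c - b"] by simp
next
  case False
  then show ?thesis using assms that[of "c + n - b"] by (simp add: add_mod_eq_if)
qed

lemma sum_lessThan_eq_4:
  fixes f :: "nat \<Rightarrow> 'a::comm_monoid_add"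
  assumes "4 \<le> q" "\<And>h. 4 \<le> h \<Longrightarrow> h < q \<Longrightarrow> f h = 0"
  shows "(\<Sum>h<q. f h) = f 0 + f 1 + f 2 + f 3"
proof -
  have "f h = 0" if "h \<in> {..<q} - {0, 1, 2, 3}" for h
  proof -
    have "4 \<le> h" using that by auto
    then show ?thesis using assms(2) that by simp
  qed
  then have "(\<Sum>h<q. f h) = (\<Sum>h\<in>{0, 1, 2, 3}. f h)"
    using assms(1) by (intro sum.mono_neutral_right) auto
  then show ?thesis by (simp add: add.assoc)
qed

lemma sum_lessThan_eq_2:
  fixes f :: "nat \<Rightarrow> 'a::comm_monoid_add"
  assumes "k < q" "l < q" "k \<noteq> l" "\<And>h. h < q \<Longrightarrow> h \<noteq> k \<Longrightarrow> h \<noteq> l \<Longrightarrow> f h = 0"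
  shows "(\<Sum>h<q. f h) = f k + f l"
proof -
  have "(\<Sum>h<q. f h) = (\<Sum>h\<in>{k, l}. f h)"
    using assms by (intro sum.mono_neutral_right) auto
  then show ?thesis using assms by simp
qed

lemma sum_lessThan_eq_1:
  fixes f :: "nat \<Rightarrow> 'a::comm_monoid_add"
  assumes "k < q" "\<And>h. h < q \<Longrightarrow> h \<noteq> k \<Longrightarrow> f h = 0"
  shows "(\<Sum>h<q. f h) = f k"
proof -
  have "(\<Sum>h<q. f h) = (\<Sum>h\<in>{k}. f h)"
    using assms by (intro sum.mono_neutral_right) auto
  then show ?thesis by simp
qed

locale block_array =
  fixes n q r :: nat
  assumes q: "4 \<le> q" and r: "0 < r" and qr: "q * r \<le> n"
begin

text \<open>Class \<open>h\<close> consists of the \<open>r\<close> cyclic diagonals \<open>c = b + off h v (mod n)\<close>. The first four classes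
  are interleaved because a gadget needs four consecutive diagonals.\<close>

definition off :: "nat \<Rightarrow> nat \<Rightarrow> nat" where
  "off h v = (if h < 4 then 4 * v + h else h * r + v)"

lemma n4: "4 \<le> n"
proof -
  have "4 * 1 \<le> q * r" using q r by (intro mult_le_mono) auto
  then show ?thesis using qr by simp
qed

lemma off_less:
  assumes "h < q" "v < r"
  shows "off h v < q * r"
proof (cases "h < 4")
  case True
  have "4 * v + h < 4 * Suc v" using True by simp
  also have "\<dots> \<le> q * r" using assms q by (intro mult_le_mono) auto
  finally show ?thesis using True by (simp add: off_def)
next
  case False
  have "h * r + v < Suc h * r" using assms by simp
  also have "\<dots> \<le> q * r" using assms by (intro mult_le_mono) auto
  finally show ?thesis using False by (simp add: off_def)
qed

lemma off_less_n: "h < q \<Longrightarrow> v < r \<Longrightarrow> off h v < n"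
  using off_less qr by (meson less_le_trans)

lemma off_inverse:
  assumes "v < r"
  shows "(if off h v < 4 * r then (off h v mod 4, off h v div 4) else (off h v div r, off h v mod r)) = (h, v)"
proof (cases "h < 4")
  case True
  then show ?thesis using assms by (simp add: off_def)
next
  case False
  then have "4 * r \<le> h * r" by (intro mult_le_mono) auto
  then have "\<not> off h v < 4 * r" using False by (simp add: off_def not_less trans_le_add1)
  then show ?thesis using assms False by (simp add: off_def)
qed

lemma off_inj:
  assumes "off h v = off h' v'" "v < r" "v' < r"
  shows "h = h' \<and> v = v'"
  using off_inverse[OF assms(2), of h] off_inverse[OF assms(3), of h'] assms(1)
  by (metis prod.inject)

lemma off_surj:
  assumes "d < q * r"
  obtains h v where "h < q" "v < r" "off h v = d"
proof (cases "d < 4 * r")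
  case True
  show ?thesis
  proof (rule that)
    have "d mod 4 < 4" by simp
    then show "d mod 4 < q" using q by linarith
    show "d div 4 < r" using True by (simp add: less_mult_imp_div_less mult.commute)
    show "off (d mod 4) (d div 4) = d" unfolding off_def by simp
  qed
next
  case False
  then have "4 \<le> d div r" using r by (simp add: less_eq_div_iff_mult_less_eq)
  moreover have "d div r < q" using assms by (simp add: less_mult_imp_div_less)
  moreover have "off (d div r) (d mod r) = d"
    using \<open>4 \<le> d div r\<close> unfolding off_def by simp
  ultimately show ?thesis using that[of "d div r" "d mod r"] r by simp
qed

definition graph :: "nat \<Rightarrow> (nat \<times> nat) set" where
  "graph h = {(b, c). b < n \<and> c < n \<and> (\<exists>v<r. c = (b + off h v) mod n)}"

lemma graph_disjoint:
  assumes "(b, c) \<in> graph h" "(b, c) \<in> graph h'" "h < q" "h' < q"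
  shows "h = h'"
proof -
  obtain v v' where v: "v < r" "v' < r" "b < n" "c = (b + off h v) mod n" "c = (b + off h' v') mod n"
    using assms(1,2) unfolding graph_def by blast
  have "off h v = off h' v'"
    using v(4,5) by (intro add_mod_inj[OF v(3) off_less_n[OF assms(3) v(1)] off_less_n[OF assms(4) v(2)]]) simp
  then show ?thesis using off_inj v by blast
qed

lemma graph_not_leftover:
  assumes "(b, (b + i) mod n) \<in> graph h" "h < q" "i < n"
  shows "i < q * r"
proof -
  obtain v where v: "v < r" "b < n" "(b + i) mod n = (b + off h v) mod n"
    using assms(1) unfolding graph_def by blast
  have "i = off h v" by (rule add_mod_inj[OF v(2) assms(3) off_less_n[OF assms(2) v(1)] v(3)])
  then show ?thesis using off_less[OF assms(2) v(1)] by simp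
qed

lemma graph_cases:
  assumes "b < n" "c < n"
  obtains h where "h < q" "(b, c) \<in> graph h"
    | i where "q * r \<le> i" "i < n" "c = (b + i) mod n"
proof -
  obtain d where d: "d < n" "c = (b + d) mod n" using add_mod_obtain assms by blast
  show ?thesis
  proof (cases "d < q * r")
    case True
    then obtain h v where "h < q" "v < r" "off h v = d" by (rule off_surj)
    then have "(b, c) \<in> graph h" using d assms unfolding graph_def by blast
    then show ?thesis by (rule that(1)[OF \<open>h < q\<close>])
  next
    case False
    then have "q * r \<le> d" by simp
    then show ?thesis by (rule that(2)[OF _ d])
  qed
qed

lemma regular_graph:
  assumes h: "h < q"
  shows "regular n r (graph h)"
proof -
  have n: "0 < n" using n4 by simp
  have "card (graph h `` {b}) = r" if b: "b < n" for b
  proof -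
    have "graph h `` {b} = (\<lambda>v. (b + off h v) mod n) ` {..<r}"
    proof (intro set_eqI iffI)
      fix c assume "c \<in> graph h `` {b}"
      then show "c \<in> (\<lambda>v. (b + off h v) mod n) ` {..<r}" by (auto simp: graph_def)
    next
      fix c assume "c \<in> (\<lambda>v. (b + off h v) mod n) ` {..<r}"
      then obtain v where "v < r" "c = (b + off h v) mod n" by blast
      then show "c \<in> graph h `` {b}" using b n by (auto simp: graph_def)
    qed
    moreover have "inj_on (\<lambda>v. (b + off h v) mod n) {..<r}"
    proof (rule inj_onI)
      fix v w assume vw: "v \<in> {..<r}" "w \<in> {..<r}" "(b + off h v) mod n = (b + off h w) mod n"
      then have "off h v = off h w" using add_mod_inj[OF b off_less_n[OF h] off_less_n[OF h]] by simp
      then show "v = w" using off_inj vw by blast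
    qed
    ultimately show ?thesis by (simp add: card_image)
  qed
  moreover have "card ((graph h)\<inverse> `` {c}) = r" if c: "c < n" for c
  proof -
    have "(graph h)\<inverse> `` {c} = (\<lambda>v. (c + (n - off h v)) mod n) ` {..<r}"
    proof (intro set_eqI iffI)
      fix b assume "b \<in> (graph h)\<inverse> `` {c}"
      then obtain v where "b < n" "v < r" "c = (b + off h v) mod n" by (auto simp: graph_def)
      then show "b \<in> (\<lambda>v. (c + (n - off h v)) mod n) ` {..<r}"
        using add_mod_shift[of b n c] c off_less_n[OF h] by blast
    next
      fix b assume "b \<in> (\<lambda>v. (c + (n - off h v)) mod n) ` {..<r}"
      then obtain v where v: "v < r" "b = (c + (n - off h v)) mod n" by blast
      then have "b < n" using n by simp
      then have "c = (b + off h v) mod n" using add_mod_shift[of b n c] c off_less_n[OF h] v by blast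
      then show "b \<in> (graph h)\<inverse> `` {c}" using \<open>b < n\<close> c v by (auto simp: graph_def)
    qed
    moreover have "inj_on (\<lambda>v. (c + (n - off h v)) mod n) {..<r}"
    proof (rule inj_onI)
      fix v w assume vw: "v \<in> {..<r}" "w \<in> {..<r}" "(c + (n - off h v)) mod n = (c + (n - off h w)) mod n"
      define b where "b = (c + (n - off h v)) mod n"
      have b: "b < n" using n by (simp add: b_def)
      have "c = (b + off h v) mod n" "c = (b + off h w) mod n"
        using add_mod_shift[OF b c off_less_n[OF h]] vw b_def by auto
      then have "off h v = off h w" using add_mod_inj[OF b off_less_n[OF h] off_less_n[OF h]] vw by simp
      then show "v = w" using off_inj vw by blast
    qed
    ultimately show ?thesis by (simp add: card_image)
  qed
  moreover have "graph h \<subseteq> {..<n} \<times> {..<n}" by (auto simp: graph_def)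
  ultimately show ?thesis by (simp add: regular_def)
qed

text \<open>\<open>F g h v b\<close> is the symbol that row \<open>v\<close> of group
  \<open>g\<close> has for class \<open>h\<close> in column \<open>b\<close>. Every pair
  \<open>(g, h)\<close> gets a 1-factorization, even one of weight zero: positions are then uniform,
  and the weights alone select the support.\<close>

definition factorization_family :: "(nat \<Rightarrow> nat \<Rightarrow> nat \<Rightarrow> nat \<Rightarrow> nat) \<Rightarrow> bool" where
  "factorization_family F \<longleftrightarrow>
     (\<forall>g h v. g < q \<longrightarrow> h < q \<longrightarrow> v < r \<longrightarrow> bij_betw (F g h v) {..<n} {..<n}) \<and>
     (\<forall>g h v b. g < q \<longrightarrow> h < q \<longrightarrow> v < r \<longrightarrow> b < n \<longrightarrow> (b, F g h v b) \<in> graph h) \<and>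
     (\<forall>g h b c. g < q \<longrightarrow> h < q \<longrightarrow> (b, c) \<in> graph h \<longrightarrow> (\<exists>!v. v < r \<and> F g h v b = c))"

end

subsection \<open>Arrays built from one-factorizations\<close>

locale array_family = block_array +
  fixes F :: "nat \<Rightarrow> nat \<Rightarrow> nat \<Rightarrow> nat \<Rightarrow> nat"
  assumes F: "factorization_family F"
begin

lemmas F_bij = F[unfolded factorization_family_def, THEN conjunct1, rule_format]
lemmas F_graph = F[unfolded factorization_family_def, THEN conjunct2, THEN conjunct1, rule_format]
lemmas F_ex1 = F[unfolded factorization_family_def, THEN conjunct2, THEN conjunct2, rule_format]

lemma F_less:
  assumes "g < q" "h < q" "v < r" "b < n"
  shows "F g h v b < n"
  using F_graph[OF assms] by (simp add: graph_def)

lemma F_class_unique: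
  assumes "F g h v b = F g h' v b" "g < q" "h < q" "h' < q" "v < r" "b < n"
  shows "h = h'"
proof (rule graph_disjoint)
  show "(b, F g h v b) \<in> graph h" by (rule F_graph[OF assms(2,3,5,6)])
  show "(b, F g h v b) \<in> graph h'" unfolding assms(1) by (rule F_graph[OF assms(2,4,5,6)])
qed fact+

text \<open>Row \<open>g * r + v\<close> is the \<open>v\<close>-th row of group \<open>g\<close>; the rows from \<open>q * r\<close> on are left over and
  carry a cyclic diagonal of their own.\<close>

definition array :: "(nat \<Rightarrow> nat \<Rightarrow> nat \<Rightarrow> nat \<Rightarrow> real) \<Rightarrow> real \<Rightarrow> nat \<Rightarrow> nat \<Rightarrow> nat \<Rightarrow> real" where
  "array w e i b c =
     (if i < q * r then \<Sum>h<q. if F (i div r) h (i mod r) b = c then w (i div r) h (i mod r) b else 0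
      else if c = (b + i) mod n then e else 0)"

lemma row_index:
  assumes "g < q" "v < r"
  shows "g * r + v < q * r" "(g * r + v) div r = g" "(g * r + v) mod r = v"
proof -
  have "g * r + v < Suc g * r" using assms by simp
  also have "\<dots> \<le> q * r" using assms by (intro mult_le_mono) auto
  finally show "g * r + v < q * r" .
  show "(g * r + v) div r = g" "(g * r + v) mod r = v" using assms(2) by simp_all
qed

lemma row_split:
  assumes "i < q * r"
  shows "i div r < q" "i mod r < r" "i = i div r * r + i mod r"
proof -
  show "i div r < q" using assms by (rule less_mult_imp_div_less)
  show "i mod r < r" using r by simp
  show "i = i div r * r + i mod r" by simp
qed

lemma array_block:
  assumes "g < q" "v < r"
  shows "array w e (g * r + v) b c = (\<Sum>h<q. if F g h v b = c then w g h v b else 0)"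
  using row_index(1)[OF assms] by (simp only: array_def row_index(2,3)[OF assms] if_True)

lemma array_F:
  assumes "g < q" "h < q" "v < r" "b < n"
  shows "array w e (g * r + v) b (F g h v b) = w g h v b"
proof -
  have "(if F g h' v b = F g h v b then w g h' v b else 0) = (if h' = h then w g h v b else 0)"
    if "h' < q" for h'
    using F_class_unique[of g h' v b h] assms that by (cases "h' = h") auto
  then have "array w e (g * r + v) b (F g h v b) = (\<Sum>h'<q. if h' = h then w g h v b else 0)"
    unfolding array_block[OF assms(1,3)] by (intro sum.cong) auto
  then show ?thesis using assms by simp
qed

lemma array_off_F:
  assumes "g < q" "v < r" "\<And>h. h < q \<Longrightarrow> F g h v b \<noteq> c"
  shows "array w e (g * r + v) b c = 0"
  unfolding array_block[OF assms(1,2)] using assms(3) by (intro sum.neutral) auto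

lemma array_leftover:
  assumes "q * r \<le> i"
  shows "array w e i b c = (if c = (b + i) mod n then e else 0)"
  using assms by (simp add: array_def)

text \<open>The line sums are computed for arbitrary \<open>w\<close> and \<open>e\<close> because
  they are used twice: with \<open>W\<close> and \<open>1\<close> for the tristochastic array, with
  \<open>z\<close> and \<open>0\<close> for arrays with vanishing line sums.\<close>

lemma sum_symbol_block:
  assumes "g < q" "v < r" "b < n"
  shows "(\<Sum>c<n. array w e (g * r + v) b c) = (\<Sum>h<q. w g h v b)"
proof -
  have "(\<Sum>c<n. array w e (g * r + v) b c) = (\<Sum>h<q. \<Sum>c<n. if F g h v b = c then w g h v b else 0)"
    unfolding array_block[OF assms(1,2)] by (rule sum.swap)
  also have "\<dots> = (\<Sum>h<q. w g h v b)"
    using F_less[OF assms(1) _ assms(2,3)] by (intro sum.cong) auto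
  finally show ?thesis .
qed

lemma sum_column_block:
  assumes "g < q" "v < r" "\<And>h. h < q \<Longrightarrow> B h < n \<and> F g h v (B h) = c"
  shows "(\<Sum>b<n. array w e (g * r + v) b c) = (\<Sum>h<q. w g h v (B h))"
proof -
  have "(\<Sum>b<n. array w e (g * r + v) b c) = (\<Sum>h<q. \<Sum>b<n. if F g h v b = c then w g h v b else 0)"
    unfolding array_block[OF assms(1,2)] by (rule sum.swap)
  also have "\<dots> = (\<Sum>h<q. w g h v (B h))"
  proof (rule sum.cong)
    fix h assume "h \<in> {..<q}"
    then have h: "h < q" by simp
    have "inj_on (F g h v) {..<n}" using F_bij[OF assms(1) h assms(2)] by (simp add: bij_betw_def)
    then have "F g h v b = c \<longleftrightarrow> b = B h" if "b < n" for b
      using assms(3)[OF h] that by (metis inj_onD lessThan_iff)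
    then have "(\<Sum>b<n. if F g h v b = c then w g h v b else 0) = (\<Sum>b<n. if b = B h then w g h v (B h) else 0)"
      by (intro sum.cong) auto
    then show "(\<Sum>b<n. if F g h v b = c then w g h v b else 0) = w g h v (B h)"
      using assms(3)[OF h] by simp
  qed simp
  finally show ?thesis .
qed

text \<open>\<open>V g\<close> is the unique row of group \<open>g\<close> whose
  class-\<open>h\<close> matching contains \<open>(b, c)\<close>. Cells of other classes cannot lie
  on this line since the classes are disjoint, and leftover rows use other diagonals.\<close>

lemma sum_row_block:
  assumes h: "h < q" and bc: "(b, c) \<in> graph h" and V: "\<And>g. g < q \<Longrightarrow> V g < r \<and> F g h (V g) b = c"
  shows "(\<Sum>i<n. array w e i b c) = (\<Sum>g<q. w g h (V g) b)"
proof -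
  have bn: "b < n" using bc by (auto simp: graph_def)
  have left: "array w e i b c = 0" if "i \<in> {..<n} - {..<q * r}" for i
    using that graph_not_leftover[of b i h] bc h by (auto simp: array_leftover not_less)
  have "(\<Sum>i<n. array w e i b c) = (\<Sum>i<q * r. array w e i b c)"
    using left qr by (intro sum.mono_neutral_right) auto
  also have "\<dots> = (\<Sum>i<q * r. (\<lambda>g v. array w e (g * r + v) b c) (i div r) (i mod r))"
    by simp
  also have "\<dots> = (\<Sum>g<q. \<Sum>v<r. array w e (g * r + v) b c)"
    by (rule sum_div_mod[OF r])
  also have "\<dots> = (\<Sum>g<q. w g h (V g) b)"
  proof (rule sum.cong)
    fix g assume "g \<in> {..<q}"
    then have g: "g < q" by simp
    have "array w e (g * r + v) b c = (if v = V g then w g h (V g) b else 0)" if v: "v < r" for v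
    proof (cases "v = V g")
      case True
      then show ?thesis using array_F[OF g h v bn] V[OF g] by auto
    next
      case False
      have "F g h' v b \<noteq> c" if h': "h' < q" for h'
      proof
        assume eq: "F g h' v b = c"
        then have "h' = h" using F_graph[OF g h' v bn] graph_disjoint bc h h' by blast
        then show False using F_ex1[OF g h bc] V[OF g] v eq False by blast
      qed
      then show ?thesis using array_off_F[OF g v] False by simp
    qed
    then have "(\<Sum>v<r. array w e (g * r + v) b c) = (\<Sum>v<r. if v = V g then w g h (V g) b else 0)"
      by (intro sum.cong) auto
    then show "(\<Sum>v<r. array w e (g * r + v) b c) = w g h (V g) b" using V[OF g] by simp
  qed simp
  finally show ?thesis .
qed

lemma sum_leftover:
  assumes "q * r \<le> i" "i < n"
  shows "b < n \<Longrightarrow> (\<Sum>c<n. array w e i b c) = e"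
    and "c < n \<Longrightarrow> (\<Sum>b<n. array w e i b c) = e"
proof -
  show "(\<Sum>c<n. array w e i b c) = e" if "b < n"
    using assms that by (simp add: array_leftover)
  show "(\<Sum>b<n. array w e i b c) = e" if c: "c < n"
  proof -
    have "array w e i b c = (if b = (c + (n - i)) mod n then e else 0)" if "b < n" for b
      using add_mod_shift[OF that c assms(2)] assms(1) by (simp add: array_leftover)
    then have "(\<Sum>b<n. array w e i b c) = (\<Sum>b<n. if b = (c + (n - i)) mod n then e else 0)"
      by (intro sum.cong) auto
    then show ?thesis using c by simp
  qed
qed

lemma sum_row_leftover:
  assumes "q * r \<le> i" "i < n" "b < n"
  shows "(\<Sum>i'<n. array w e i' b ((b + i) mod n)) = e"
proof -
  have "array w e i' b ((b + i) mod n) = (if i' = i then e else 0)" if i': "i' < n" for i'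
  proof (cases "i' < q * r")
    case True
    have "F g h v b \<noteq> (b + i) mod n" if "g < q" "h < q" "v < r" for g h v
    proof
      assume "F g h v b = (b + i) mod n"
      then have "i < q * r"
        using graph_not_leftover[of b i h] F_graph[OF that assms(3)] that(2) assms(2) by simp
      then show False using assms(1) by simp
    qed
    then have "array w e (i' div r * r + i' mod r) b ((b + i) mod n) = 0"
      using row_split(1,2)[OF True] by (intro array_off_F) auto
    then have "array w e i' b ((b + i) mod n) = 0" by simp
    moreover have "i' \<noteq> i" using True assms by simp
    ultimately show ?thesis by simp
  next
    case False
    then have "array w e i' b ((b + i) mod n) = (if (b + i) mod n = (b + i') mod n then e else 0)"
      by (simp add: array_leftover)
    then show ?thesis using add_mod_inj[OF assms(3,2) i'] by (cases "i' = i") auto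
  qed
  then have "(\<Sum>i'<n. array w e i' b ((b + i) mod n)) = (\<Sum>i'<n. if i' = i then e else 0)"
    by (intro sum.cong) auto
  then show ?thesis using assms by simp
qed

end

subsection \<open>The weights\<close>

text \<open>The wrap-around gives class \<open>0\<close> the half that groups \<open>0\<close> and
  \<open>1\<close> leave open.\<close>

definition next_class :: "nat \<Rightarrow> nat \<Rightarrow> nat" where
  "next_class q g = (if Suc g = q then 0 else Suc g)"

text \<open>The layers of the gadget rows \<open>0\<close> and \<open>1\<close> are \<open>1 - L/2\<close>, where \<open>L\<close> is the Laplacian of the edge
  \<open>{0, 1}\<close> and of the complementary path of the cycle \<open>0, 1, \<dots>, n - 1\<close>, respectively.\<close>

definition weight :: "nat \<Rightarrow> nat \<Rightarrow> nat \<Rightarrow> nat \<Rightarrow> real" where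
  "weight q g h b =
     (if g = 0 then
        (if h = 0 then (if b = 1 then 1/2 else 0)
         else if h = 1 then (if b < 2 then 1/2 else 1)
         else if h = 2 then (if b = 0 then 1/2 else 0) else 0)
      else if g = 1 then
        (if h = 0 then (if b = 1 then 0 else 1/2)
         else if h = 1 then (if b < 2 then 1/2 else 0)
         else if h = 2 then (if b = 0 then 0 else 1/2) else 0)
      else if g = 2 then (if h = 2 \<or> h = 3 then 1/2 else 0)
      else if h = g \<or> h = next_class q g then 1/2 else 0)"

lemma weight_gadget:
  "weight q 0 0 b = (if b = Suc 0 then 1/2 else 0)"
  "weight q 0 (Suc 0) b = (if b < 2 then 1/2 else 1)"
  "weight q 0 2 b = (if b = 0 then 1/2 else 0)"
  "weight q 0 3 b = 0"
  "weight q (Suc 0) 0 b = (if b = Suc 0 then 0 else 1/2)"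
  "weight q (Suc 0) (Suc 0) b = (if b < 2 then 1/2 else 0)"
  "weight q (Suc 0) 2 b = (if b = 0 then 0 else 1/2)"
  "weight q (Suc 0) 3 b = 0"
  "weight q 2 0 b = 0" "weight q 2 (Suc 0) b = 0" "weight q 2 2 b = 1/2" "weight q 2 3 b = 1/2"
  by (simp_all add: weight_def)

lemma weight_gadget_high:
  assumes "g < 3" "4 \<le> h"
  shows "weight q g h b = 0"
proof -
  have "g = 0 \<or> g = 1 \<or> g = 2" using assms(1) by auto
  then show ?thesis using assms(2) by (elim disjE) (simp_all add: weight_def)
qed

lemma weight_chain:
  assumes "3 \<le> g"
  shows "weight q g h b = (if h = g \<or> h = next_class q g then 1/2 else 0)"
proof -
  have "g \<noteq> 0" "g \<noteq> 1" "g \<noteq> 2" using assms by auto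
  then show ?thesis by (simp only: weight_def if_False)
qed

lemma weight_nonneg: "0 \<le> weight q g h b"
proof -
  have *: "0 \<le> (if P then x else y)" if "0 \<le> x" "0 \<le> y" for P and x y :: real
    using that by simp
  show ?thesis unfolding weight_def by (intro *) simp_all
qed

lemma next_class:
  assumes "4 \<le> q" "g < q"
  shows "next_class q g < q" "next_class q g \<noteq> g"
  using assms by (auto simp: next_class_def)

lemma sum_weight_class:
  assumes "4 \<le> q" "g < q"
  shows "(\<Sum>h<q. weight q g h b) = 1"
proof (cases "g < 3")
  case True
  have "(\<Sum>h<q. weight q g h b) = weight q g 0 b + weight q g 1 b + weight q g 2 b + weight q g 3 b"
    using weight_gadget_high[OF True] by (rule sum_lessThan_eq_4[OF assms(1)])
  moreover have "g = 0 \<or> g = 1 \<or> g = 2" using True by auto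
  ultimately show ?thesis by (elim disjE) (simp_all add: weight_gadget)
next
  case False
  then have g: "3 \<le> g" by simp
  have "(\<Sum>h<q. weight q g h b) = weight q g g b + weight q g (next_class q g) b"
  proof (rule sum_lessThan_eq_2)
    show "weight q g h b = 0" if "h \<noteq> g" "h \<noteq> next_class q g" for h
      using that by (simp add: weight_chain[OF g])
  qed (use assms next_class[OF assms] in auto)
  then show ?thesis by (simp add: weight_chain[OF g])
qed

lemma sum_weight_group:
  assumes "4 \<le> q" "h < q"
  shows "(\<Sum>g<q. weight q g h b) = 1"
proof -
  \<comment> \<open>The gadget fills classes \<open>1\<close> and \<open>2\<close> completely and
    classes \<open>0\<close> and \<open>3\<close> by half. The chain supplies the rest: class
    \<open>3\<close> from group \<open>3\<close>, class \<open>0\<close> from group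
    \<open>q - 1\<close>, any later class from group \<open>h\<close> and its predecessor
    \<open>p\<close>.\<close>
  have gad: "weight q 0 h b + weight q 1 h b + weight q 2 h b =
      (if h = 0 then 1/2 else if h = 1 then 1 else if h = 2 then 1 else if h = 3 then 1/2 else 0)"
  proof -
    have "h = 0 \<or> h = 1 \<or> h = 2 \<or> h = 3 \<or> 4 \<le> h" by auto
    then show ?thesis
      by (elim disjE) (simp_all add: weight_gadget weight_gadget_high)
  qed
  define p where "p = (if h = 0 then q - 1 else h - 1)"
  have chain: "weight q g h b = (if g = h then 1/2 else 0) + (if g = p then 1/2 else 0)"
    if g: "3 \<le> g" "g < q" for g
  proof -
    have "h = next_class q g \<longleftrightarrow> g = p" using assms g by (auto simp: next_class_def p_def)
    moreover have "p \<noteq> h" using assms by (auto simp: p_def)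
    ultimately show ?thesis unfolding weight_chain[OF g(1)] by auto
  qed
  have "{..<q} = {..<3} \<union> {3..<q}" using assms by auto
  then have "(\<Sum>g<q. weight q g h b) = (\<Sum>g<3. weight q g h b) + (\<Sum>g\<in>{3..<q}. weight q g h b)"
    by (simp add: sum.union_disjoint ivl_disj_int)
  also have "(\<Sum>g<3. weight q g h b) = weight q 0 h b + weight q 1 h b + weight q 2 h b"
    by (simp add: eval_nat_numeral)
  also have "(\<Sum>g\<in>{3..<q}. weight q g h b) =
      (\<Sum>g\<in>{3..<q}. (if g = h then 1/2 else 0) + (if g = p then 1/2 else 0))"
    using chain by (intro sum.cong) auto
  also have "\<dots> = (if 3 \<le> h then 1/2 else 0) + (if h = 0 \<or> 4 \<le> h then 1/2 else 0)"
    using assms by (simp add: sum.distrib p_def) auto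
  finally show ?thesis unfolding gad by simp
qed

locale gadget_family = array_family +
  assumes gadget: "\<And>g h v b. g < 3 \<Longrightarrow> h < q \<Longrightarrow> v < r \<Longrightarrow> b < n \<Longrightarrow> F g h v b = (b + off h v) mod n"
begin

lemma off_4: "h < 4 \<Longrightarrow> off h v = 4 * v + h"
  by (simp add: off_def)

text \<open>The cells of a gadget row \<open>(g, v)\<close> carrying the symbol of the column \<open>b\<close> in class \<open>1\<close> lie,
  in the classes \<open>0\<close>, \<open>1\<close>, \<open>2\<close>, \<open>3\<close>, in the columns \<open>b + 1\<close>, \<open>b\<close>, \<open>b - 1\<close>, \<open>b - 2\<close>.\<close>

lemma sum_column_gadget:
  assumes g: "g < 3" and v: "v < r" and b: "b < n"
    and w: "\<And>h b. 4 \<le> h \<Longrightarrow> w g h v b = 0"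
  shows "(\<Sum>b'<n. array w e (g * r + v) b' ((b + off 1 v) mod n)) =
    w g 0 v ((b + 1) mod n) + w g 1 v b + w g 2 v ((b + (n - 1)) mod n) + w g 3 v ((b + (n - 2)) mod n)"
proof -
  have n: "0 < n" "g < q" using n4 g q by auto
  define c where "c = (b + off 1 v) mod n"
  define B where "B h = (if h = 0 then (b + 1) mod n else if h = 1 then b else if h = 2 then (b + (n - 1)) mod n
    else if h = 3 then (b + (n - 2)) mod n else (c + (n - off h v)) mod n)" for h
  have "B h < n \<and> F g h v (B h) = c" if h: "h < q" for h
  proof -
    have Bn: "B h < n" using n b by (auto simp: B_def)
    have "(B h + off h v) mod n = c"
    proof (cases "h < 4")
      case True
      then have "h = 0 \<or> h = 1 \<or> h = 2 \<or> h = 3" by auto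
      moreover have "((b + 1) mod n + 4 * v) mod n = (b + (4 * v + 1)) mod n"
        by (simp add: mod_add_left_eq)
      moreover have "((b + (n - 1)) mod n + (4 * v + 2)) mod n = (b + (4 * v + 1)) mod n"
      proof -
        have "((b + (n - 1)) mod n + (4 * v + 2)) mod n = (b + (n - 1) + (4 * v + 2)) mod n"
          by (rule mod_add_left_eq)
        also have "b + (n - 1) + (4 * v + 2) = b + (4 * v + 1) + n" using n by simp
        finally show ?thesis unfolding mod_add_self2 .
      qed
      moreover have "((b + (n - 2)) mod n + (4 * v + 3)) mod n = (b + (4 * v + 1)) mod n"
      proof -
        have "((b + (n - 2)) mod n + (4 * v + 3)) mod n = (b + (n - 2) + (4 * v + 3)) mod n"
          by (rule mod_add_left_eq)
        also have "b + (n - 2) + (4 * v + 3) = b + (4 * v + 1) + n" using n4 by simp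
        finally show ?thesis unfolding mod_add_self2 .
      qed
      ultimately show ?thesis by (auto simp: B_def c_def off_4)
    next
      case False
      have "c < n" using n by (simp add: c_def)
      moreover have "B h = (c + (n - off h v)) mod n" using False by (simp add: B_def)
      ultimately show ?thesis using add_mod_shift[OF Bn _ off_less_n[OF h v], of c] by simp
    qed
    then show ?thesis using gadget[OF g h v Bn] Bn by simp
  qed
  then have "(\<Sum>b'<n. array w e (g * r + v) b' c) = (\<Sum>h<q. w g h v (B h))"
    by (rule sum_column_block[OF n(2) v])
  also have "\<dots> = w g 0 v (B 0) + w g 1 v (B 1) + w g 2 v (B 2) + w g 3 v (B 3)"
    using q w by (intro sum_lessThan_eq_4) auto
  finally show ?thesis by (simp add: B_def c_def)
qed

lemma column_representative:
  assumes "v < r" "c < n"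
  obtains b where "b < n" "c = (b + off 1 v) mod n"
proof
  have "1 < q" using q by simp
  then show "c = ((c + (n - off 1 v)) mod n + off 1 v) mod n"
    using add_mod_shift[of "(c + (n - off 1 v)) mod n" n c "off 1 v"] assms off_less_n[of 1 v] by simp
qed (use n4 in simp)

text \<open>The dummy argument \<open>v\<close> fits the format of \<open>array\<close>, where
  arrays with vanishing line sums do depend on the row.\<close>

definition W :: "nat \<Rightarrow> nat \<Rightarrow> nat \<Rightarrow> nat \<Rightarrow> real" where
  "W g h v b = weight q g h b"

lemma neighbour_columns:
  assumes "b < n"
  shows "(b + 1) mod n = 1 \<longleftrightarrow> b = 0" "(b + (n - 1)) mod n = 0 \<longleftrightarrow> b = 1"
proof -
  have "1 \<le> n" "n - 1 \<le> n" using n4 by auto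
  then have "(b + 1) mod n = (if b + 1 < n then b + 1 else b + 1 - n)"
    "(b + (n - 1)) mod n = (if b + (n - 1) < n then b + (n - 1) else b + (n - 1) - n)"
    using add_mod_eq_if[OF assms] by blast+
  then show "(b + 1) mod n = 1 \<longleftrightarrow> b = 0" "(b + (n - 1)) mod n = 0 \<longleftrightarrow> b = 1"
    using assms n4 by (simp_all only: split: if_split) arith+
qed

lemma array_nonneg: "0 \<le> array W 1 i b c"
  by (auto simp: array_def W_def weight_nonneg intro!: sum_nonneg)

lemma array_symbol_sum:
  assumes "i < n" "b < n"
  shows "(\<Sum>c<n. array W 1 i b c) = 1"
proof (cases "i < q * r")
  case True
  then show ?thesis
    using sum_symbol_block[OF row_split(1,2)[OF True] assms(2), of W 1] row_split(3)[OF True]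
      sum_weight_class[OF q row_split(1)[OF True]] by (simp add: W_def)
next
  case False
  then show ?thesis using sum_leftover(1) assms by simp
qed

lemma array_column_sum:
  assumes i: "i < n" and c: "c < n"
  shows "(\<Sum>b<n. array W 1 i b c) = 1"
proof (cases "i < q * r")
  case True
  define g v where "g = i div r" and "v = i mod r"
  have gv: "g < q" "v < r" "i = g * r + v" using row_split[OF True] by (auto simp: g_def v_def)
  show ?thesis
  proof (cases "g < 3")
    case g: True
    obtain b where b: "b < n" "c = (b + off 1 v) mod n"
      using column_representative[OF gv(2) c] by blast
    have "(\<Sum>b<n. array W 1 i b c) =
      W g 0 v ((b + 1) mod n) + W g 1 v b + W g 2 v ((b + (n - 1)) mod n) + W g 3 v ((b + (n - 2)) mod n)"
      unfolding gv(3) b(2) using weight_gadget_high[OF g] by (intro sum_column_gadget[OF g gv(2) b(1)]) (simp add: W_def)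
    moreover have "g = 0 \<or> g = 1 \<or> g = 2" using g by auto
    ultimately show ?thesis
      using neighbour_columns[OF b(1)] by (elim disjE) (auto simp: W_def weight_gadget)
  next
    case False
    define B where "B h = inv_into {..<n} (F g h v) c" for h
    have B: "B h < n \<and> F g h v (B h) = c" if "h < q" for h
    proof -
      have "c \<in> F g h v ` {..<n}" using F_bij[OF gv(1) that gv(2)] c by (auto simp: bij_betw_def)
      then show ?thesis using inv_into_into[of c "F g h v" "{..<n}"] f_inv_into_f[of c "F g h v" "{..<n}"]
        by (simp add: B_def)
    qed
    have "(\<Sum>b<n. array W 1 i b c) = (\<Sum>h<q. W g h v (B h))"
      unfolding gv(3) by (rule sum_column_block[OF gv(1,2) B])
    \<comment> \<open>Chain weights are constant along columns, so the unknown columns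
      \<open>B h\<close> may be replaced by \<open>0\<close>.\<close>
    also have "\<dots> = (\<Sum>h<q. weight q g h 0)"
      using False by (intro sum.cong) (simp_all add: W_def weight_chain)
    finally show ?thesis using sum_weight_class[OF q gv(1)] by simp
  qed
next
  case False
  then show ?thesis using sum_leftover(2) assms by simp
qed

lemma array_row_sum:
  assumes b: "b < n" and c: "c < n"
  shows "(\<Sum>i<n. array W 1 i b c) = 1"
proof -
  from b c consider (block) h where "h < q" "(b, c) \<in> graph h"
    | (leftover) i where "q * r \<le> i" "i < n" "c = (b + i) mod n" by (rule graph_cases)
  then show ?thesis
  proof cases
    case block
    define V where "V g = (THE v. v < r \<and> F g h v b = c)" for g
    have "V g < r \<and> F g h (V g) b = c" if "g < q" for g
      using theI'[OF F_ex1[OF that block]] by (simp add: V_def)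
    then have "(\<Sum>i<n. array W 1 i b c) = (\<Sum>g<q. W g h (V g) b)"
      by (rule sum_row_block[OF block])
    then show ?thesis using sum_weight_group[OF q block(1)] by (simp add: W_def)
  next
    case leftover
    then show ?thesis using sum_row_leftover b by simp
  qed
qed

end

subsection \<open>Rigidity\<close>

context gadget_family
begin

text \<open>The three gadget groups share the same cyclic factorizations, so a line through one of
  them meets all three in the same row index \<open>v\<close>. The gadgets for different
  \<open>v\<close> can thus be treated separately.\<close>

lemma array_row_sum_at:
  assumes "g0 < q" "h < q" "v < r" "b < n"
  obtains V where "V g0 = v" "\<And>g. g < q \<Longrightarrow> V g < r" "g0 < 3 \<Longrightarrow> V 0 = v \<and> V 1 = v \<and> V 2 = v"
    "(\<Sum>i<n. array w e i b (F g0 h v b)) = (\<Sum>g<q. w g h (V g) b)"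
proof -
  define c where "c = F g0 h v b"
  have bc: "(b, c) \<in> graph h" unfolding c_def by (rule F_graph[OF assms])
  define V where "V g = (THE v. v < r \<and> F g h v b = c)" for g
  have V: "V g < r \<and> F g h (V g) b = c" if "g < q" for g
    using theI'[OF F_ex1[OF that assms(2) bc]] by (simp add: V_def)
  have uniq: "V g = v'" if "g < q" "v' < r" "F g h v' b = c" for g v'
    using F_ex1[OF that(1) assms(2) bc] V[OF that(1)] that by blast
  show ?thesis
  proof (rule that)
    show "V g0 = v" using uniq[OF assms(1,3)] by (simp add: c_def)
    show "V g < r" if "g < q" for g using V[OF that] by simp
    show "(\<Sum>i<n. array w e i b (F g0 h v b)) = (\<Sum>g<q. w g h (V g) b)"
      unfolding c_def[symmetric] by (rule sum_row_block[OF assms(2) bc V])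
    show "V 0 = v \<and> V 1 = v \<and> V 2 = v" if "g0 < 3"
    proof -
      have "V g = v" if "g < 3" for g
        using uniq[of g v] gadget[OF that assms(2,3,4)] gadget[OF \<open>g0 < 3\<close> assms(2,3,4)] assms(3) q that
        by (simp add: c_def)
      then show ?thesis by simp
    qed
  qed
qed

text \<open>Row group 2 makes \<open>z\<close> constant, say \<open>\<zeta>\<close>, on its class 2; then both class-1 cells over the
  column \<open>0\<close> equal \<open>\<zeta>\<close>, although they sum to zero. This kills the gadgets, and the zero
  propagates along the row groups \<open>3, 4, \<dots>\<close>.\<close>

lemma kernel_zero:
  assumes supp: "\<And>g h v b. weight q g h b = 0 \<Longrightarrow> z g h v b = 0"
    and symbol: "\<And>i b. i < n \<Longrightarrow> b < n \<Longrightarrow> (\<Sum>c<n. array z 0 i b c) = 0"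
    and column: "\<And>i c. i < n \<Longrightarrow> c < n \<Longrightarrow> (\<Sum>b<n. array z 0 i b c) = 0"
    and row: "\<And>b c. b < n \<Longrightarrow> c < n \<Longrightarrow> (\<Sum>i<n. array z 0 i b c) = 0"
    and "g < q" "h < q" "v < r" "b < n"
  shows "z g h v b = 0"
proof -
  have n: "0 < n" "1 < n" "2 < n" "3 < n" using n4 by auto
  have q4: "0 < q" "1 < q" "2 < q" "3 < q" using q by auto
  have row_n: "g * r + v < n" if "g < q" "v < r" for g v
    using row_index(1)[OF that] qr by linarith
  have sym: "(\<Sum>h<q. z g h v b) = 0" if "g < q" "v < r" "b < n" for g v b
    using sum_symbol_block[OF that, of z 0] symbol[OF row_n[OF that(1,2)] that(3)] by simp
  have high: "z g h v b = 0" if "g < 3" "4 \<le> h" for g h v b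
    using supp weight_gadget_high[OF that] by blast
  have sym_gad: "z g 0 v b + z g 1 v b + z g 2 v b + z g 3 v b = 0" if "g < 3" "v < r" "b < n" for g v b
    using sym[of g v b] sum_lessThan_eq_4[OF q, of "\<lambda>h. z g h v b"] high[OF that(1)] that q by simp
  have col_gad: "z g 0 v ((b + 1) mod n) + z g 1 v b + z g 2 v ((b + (n - 1)) mod n) + z g 3 v ((b + (n - 2)) mod n) = 0"
    if "g < 3" "v < r" "b < n" for g v b
  proof -
    have "g * r + v < n" using row_n[of g v] that q by simp
    moreover have "(b + off 1 v) mod n < n" using n by simp
    ultimately show ?thesis
      using sum_column_gadget[where w = z and e = 0 and g = g and v = v and b = b, OF that high[OF that(1)]]
        column[of "g * r + v" "(b + off 1 v) mod n"] by simp
  qed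
  have chain_zero: "z g h v b = 0" if "3 \<le> g" "h \<noteq> g" "h \<noteq> next_class q g" for g h v b
    using supp weight_chain[OF that(1)] that by simp
  have row_gad: "z 0 h v b + z 1 h v b + z 2 h v b = 0"
    if h: "h = 1 \<or> h = 2" and v: "v < r" and b: "b < n" for h v b
  proof -
    have hq: "h < q" using h q by auto
    obtain V where V: "V 0 = v" "V 1 = v" "V 2 = v"
      "(\<Sum>i<n. array z 0 i b (F 0 h v b)) = (\<Sum>g<q. z g h (V g) b)"
      using array_row_sum_at[OF q4(1) hq v b, of z 0] by (metis zero_less_numeral)
    \<comment> \<open>No chain group carries class \<open>1\<close> or \<open>2\<close>, so these
      lines stay inside the gadget.\<close>
    have "(\<Sum>g<q. z g h (V g) b) = z 0 h (V 0) b + z 1 h (V 1) b + z 2 h (V 2) b + z 3 h (V 3) b"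
    proof (rule sum_lessThan_eq_4[OF q])
      show "z g h (V g) b = 0" if "4 \<le> g" "g < q" for g
        using that h by (intro chain_zero) (auto simp: next_class_def)
    qed
    moreover have "z 3 h (V 3) b = 0" using h q by (intro chain_zero) (auto simp: next_class_def)
    moreover have "F 0 h v b < n" by (rule F_less[OF q4(1) hq v b])
    ultimately show ?thesis using V row[OF b] by simp
  qed
  have gad: "z g h v b = 0" if g: "g < 3" and h: "h < 4" and v: "v < r" and b: "b < n" for g h v b
  proof -
    have s0: "z 0 3 v b = 0" "z 1 3 v b = 0" "z 2 0 v b = 0" "z 2 1 v b = 0" for b
      by (intro supp; simp add: weight_gadget)+
    have s1: "z 0 2 v b = 0" if "b \<noteq> 0" for b using that by (intro supp) (simp add: weight_gadget)
    have s2: "z 0 0 v b = 0" if "b \<noteq> 1" for b using that by (intro supp) (simp add: weight_gadget)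
    have s3: "z 1 0 v 1 = 0" "z 1 2 v 0 = 0" by (intro supp; simp add: weight_gadget)+
    define \<zeta> where "\<zeta> = z 2 2 v 0"
    have z23: "z 2 3 v b = - z 2 2 v b" if "b < n" for b
      using sym_gad[of 2 v b] s0 v that by simp
    \<comment> \<open>In group 2 a column sum ties class 2 at \<open>b + 1\<close> to class 3 at
      \<open>b\<close>, and a symbol sum ties the latter to class 2 at \<open>b\<close>; the two
      sign changes cancel.\<close>
    have const: "z 2 2 v b = \<zeta>" if "b < n" for b
      using that
    proof (induction b)
      case 0
      show ?case by (simp add: \<zeta>_def)
    next
      case (Suc b)
      have "(b + 2) mod n < n" using n by simp
      then have "z 2 2 v (((b + 2) mod n + (n - 1)) mod n) + z 2 3 v (((b + 2) mod n + (n - 2)) mod n) = 0"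
        using col_gad[of 2 v "(b + 2) mod n"] s0 v by simp
      moreover have "((b + 2) mod n + (n - 1)) mod n = Suc b"
      proof -
        have "((b + 2) mod n + (n - 1)) mod n = (b + 2 + (n - 1)) mod n" by (rule mod_add_left_eq)
        also have "b + 2 + (n - 1) = Suc b + n" using n by simp
        finally show ?thesis unfolding mod_add_self2 using Suc.prems by simp
      qed
      moreover have "((b + 2) mod n + (n - 2)) mod n = b"
      proof -
        have "((b + 2) mod n + (n - 2)) mod n = (b + 2 + (n - 2)) mod n" by (rule mod_add_left_eq)
        also have "b + 2 + (n - 2) = b + n" using n by simp
        finally show ?thesis unfolding mod_add_self2 using Suc.prems by simp
      qed
      ultimately show ?case using z23[of b] Suc by simp
    qed
    have r2: "z 0 2 v b + z 1 2 v b = - \<zeta>" if "b < n" for b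
      using row_gad[of 2 v b] const[OF that] v that by simp
    \<comment> \<open>In class 2, of groups 0 and 1 only group 0 is supported at column
      \<open>0\<close>, and only group 1 at column \<open>n - 1\<close>. Each therefore takes all of
      \<open>- \<zeta>\<close>; a symbol sum in group 0 and a column sum in group 1 turn it into
      \<open>\<zeta>\<close> on class 1 over column \<open>0\<close>.\<close>
    have "z 0 2 v 0 = - \<zeta>" using r2[OF n(1)] s3 by simp
    then have a: "z 0 1 v 0 = \<zeta>" using sym_gad[of 0 v 0] s0 s2[of 0] v n by simp
    have b: "z 1 1 v 0 = \<zeta>"
    proof -
      have "z 1 2 v (n - 1) = - \<zeta>" using r2[of "n - 1"] s1[of "n - 1"] n by simp
      moreover have "z 1 0 v 1 + z 1 1 v 0 + z 1 2 v (n - 1) + z 1 3 v (n - 2) = 0"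
        using col_gad[of 1 v 0] v n by simp
      ultimately show ?thesis using s3 s0 by simp
    qed
    \<comment> \<open>Group 2 has no class 1, so this line reads \<open>2 * \<zeta> = 0\<close>: the
      odd cycle closes.\<close>
    have "\<zeta> = 0" using row_gad[of 1 v 0] a b s0 v n by simp
    have z2: "z 2 h v b = 0" if "b < n" "h < 4" for h b
    proof -
      have "h = 0 \<or> h = 1 \<or> h = 2 \<or> h = 3" using that by auto
      then show ?thesis using s0 const[OF that(1)] z23[OF that(1)] \<open>\<zeta> = 0\<close> by auto
    qed
    have z02: "z 0 2 v b = 0" if "b < n" for b
      using s1[of b] \<open>z 0 2 v 0 = - \<zeta>\<close> \<open>\<zeta> = 0\<close> by (cases "b = 0") auto
    have z12: "z 1 2 v b = 0" if "b < n" for b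
      using r2[OF that] z02[OF that] \<open>\<zeta> = 0\<close> by simp
    have z01: "z 0 1 v b = 0" if "b < n" for b
    proof (cases "b = 1")
      case True
      \<comment> \<open>At column \<open>1\<close> group 0 is also supported in class 0, so the
        symbol sum does not isolate the class-1 cell; the column sum does.\<close>
      have e: "(1 + 1) mod n = 2" "(1 + (n - 1)) mod n = 0" using n by auto
      have "z 0 0 v ((1 + 1) mod n) + z 0 1 v 1 + z 0 2 v ((1 + (n - 1)) mod n) + z 0 3 v ((1 + (n - 2)) mod n) = 0"
        by (rule col_gad) (use v n in auto)
      then show ?thesis unfolding e using True s2[of 2] s0 z02[of 0] n by simp
    next
      case False
      then show ?thesis using sym_gad[of 0 v b] s2[of b] z02[OF that] s0 v that by simp
    qed
    have z11: "z 1 1 v b = 0" if "b < n" for b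
      using row_gad[of 1 v b] z01[OF that] s0 v that by simp
    have z00: "z 0 0 v b = 0" if "b < n" for b
      using sym_gad[of 0 v b] z01[OF that] z02[OF that] s0 v that by simp
    have z10: "z 1 0 v b = 0" if "b < n" for b
      using sym_gad[of 1 v b] z11[OF that] z12[OF that] s0 v that by simp
    have "g = 0 \<or> g = 1 \<or> g = 2" "h = 0 \<or> h = 1 \<or> h = 2 \<or> h = 3" using g h by auto
    then show "z g h v b = 0"
      using z00 z01 z02 z10 z11 z12 z2[of _ 0] z2[of _ 1] z2[of _ 2] z2[of _ 3] s0 \<open>b < n\<close> by auto
  qed
  have "\<forall>h<q. \<forall>v<r. \<forall>b<n. z g h v b = 0" using \<open>g < q\<close>
  proof (induction g rule: less_induct)
    case (less g)
    show ?case
    proof (cases "g < 3")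
      case True
      then show ?thesis using gad high by (meson not_le)
    next
      case False
      then have g: "3 \<le> g" by simp
      \<comment> \<open>Class \<open>g\<close> occurs outside group \<open>g\<close> only in earlier
        groups, where \<open>z\<close> already vanishes; the next class wraps to \<open>0\<close>,
        never to a class \<open>g >= 3\<close>.\<close>
      have diag: "z g g v b = 0" if v: "v < r" and b: "b < n" for v b
      proof -
        obtain V where V: "V g = v" "\<And>g. g < q \<Longrightarrow> V g < r"
          "(\<Sum>i<n. array z 0 i b (F g g v b)) = (\<Sum>g'<q. z g' g (V g') b)"
          using array_row_sum_at[OF less.prems less.prems v b, of z 0] by metis
        have "(\<Sum>g'<q. z g' g (V g') b) = z g g (V g) b"
        proof (rule sum_lessThan_eq_1[OF less.prems])
          fix g' assume g': "g' < q" "g' \<noteq> g"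
          show "z g' g (V g') b = 0"
          proof (cases "g' < g")
            case True
            then show ?thesis using less.IH[OF True g'(1)] less.prems V(2)[OF g'(1)] b by blast
          next
            case False
            then show ?thesis using g g' by (intro chain_zero) (auto simp: next_class_def)
          qed
        qed
        moreover have "F g g v b < n" by (rule F_less[OF less.prems less.prems v b])
        ultimately show ?thesis using V row[OF b] by simp
      qed
      have "z g h v b = 0" if "h < q" and v: "v < r" and b: "b < n" for h v b
      proof -
        have "(\<Sum>h<q. z g h v b) = z g g v b + z g (next_class q g) v b"
          using less.prems next_class[OF q less.prems] chain_zero[OF g]
          by (intro sum_lessThan_eq_2) auto
        then have "z g (next_class q g) v b = 0" using sym[OF less.prems v b] diag[OF v b] by simp
        then show ?thesis using diag[OF v b] chain_zero[OF g, of h] by (cases "h = g \<or> h = next_class q g") auto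
      qed
      then show ?thesis by blast
    qed
  qed
  then show ?thesis using assms by blast
qed

end

subsection \<open>Counting the arrays\<close>

context gadget_family
begin

text \<open>The truncation is essential: \<open>array\<close> has diagonal entries in rows
  \<open>i >= n\<close> too.\<close>

definition vertex :: "(nat \<times> nat \<times> nat) \<Rightarrow>\<^sub>0 real" where
  "vertex = Abs_poly_mapping (\<lambda>(i, b, c). if i < n \<and> b < n \<and> c < n then array W 1 i b c else 0)"

lemma entry_vertex: "entry vertex i b c = (if i < n \<and> b < n \<and> c < n then array W 1 i b c else 0)"
proof -
  let ?f = "\<lambda>(i, b, c). if i < n \<and> b < n \<and> c < n then array W 1 i b c else 0"
  have "finite {p. ?f p \<noteq> 0}"
    by (rule finite_subset[of _ "{..<n} \<times> {..<n} \<times> {..<n}"]) (auto split: if_splits)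
  then show ?thesis by (simp add: vertex_def Abs_poly_mapping_inverse)
qed

lemma tristochastic_vertex: "tristochastic n vertex"
proof -
  have "vertex \<in> arrays n"
    by (auto simp: arrays_def in_keys_iff entry_vertex split: if_splits)
  moreover have "(\<Sum>i<n. entry vertex i b c) = 1" if "b < n" "c < n" for b c
    using array_row_sum[OF that] that by (simp add: entry_vertex)
  moreover have "(\<Sum>b<n. entry vertex i b c) = 1" if "i < n" "c < n" for i c
    using array_column_sum[OF that] that by (simp add: entry_vertex)
  moreover have "(\<Sum>c<n. entry vertex i b c) = 1" if "i < n" "b < n" for i b
    using array_symbol_sum[OF that] that by (simp add: entry_vertex)
  moreover have "0 \<le> entry vertex i b c" for i b c
    using array_nonneg by (simp add: entry_vertex)
  ultimately show ?thesis unfolding tristochastic_def by blast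
qed

lemma vertex_in_vertices: "vertex \<in> vertices (tristochastic_polytope n)"
proof (rule vertexI[OF tristochastic_vertex])
  fix x :: "nat \<Rightarrow> nat \<Rightarrow> nat \<Rightarrow> real" and i0 b0 c0
  assume supp: "\<And>i b c. entry vertex i b c = 0 \<Longrightarrow> x i b c = 0"
    and row: "\<And>b c. b < n \<Longrightarrow> c < n \<Longrightarrow> (\<Sum>i<n. x i b c) = 0"
    and column: "\<And>i c. i < n \<Longrightarrow> c < n \<Longrightarrow> (\<Sum>b<n. x i b c) = 0"
    and symbol: "\<And>i b. i < n \<Longrightarrow> b < n \<Longrightarrow> (\<Sum>c<n. x i b c) = 0"
    and bounds: "i0 < n" "b0 < n" "c0 < n"
  \<comment> \<open>The explicit zero makes the support premise of \<open>kernel_zero\<close> hold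
    for out-of-range arguments as well; within range it agrees with \<open>x\<close>.\<close>
  define z where "z g h v b = (if weight q g h b = 0 then 0 else x (g * r + v) b (F g h v b))" for g h v b
  have supp': "x i b c = 0" if "array W 1 i b c = 0" for i b c
    using supp[of i b c] that by (simp add: entry_vertex)
  have x_eq: "x i b c = array z 0 i b c" if i: "i < n" and b: "b < n" and c: "c < n" for i b c
  proof (cases "i < q * r")
    case True
    define g v where "g = i div r" and "v = i mod r"
    have gv: "g < q" "v < r" "i = g * r + v" using row_split[OF True] by (auto simp: g_def v_def)
    show ?thesis
    proof (cases "\<exists>h<q. F g h v b = c")
      case True
      then obtain h where h: "h < q" "c = F g h v b" by auto
      have "array W 1 i b c = weight q g h b"
        unfolding gv(3) h(2) using array_F[OF gv(1) h(1) gv(2) b] by (simp add: W_def)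
      moreover have "array z 0 i b c = z g h v b"
        unfolding gv(3) h(2) by (rule array_F[OF gv(1) h(1) gv(2) b])
      ultimately show ?thesis using supp'[of i b c] by (simp add: z_def gv(3) h(2))
    next
      case False
      then have none: "F g h v b \<noteq> c" if "h < q" for h using that by blast
      have "array w e i b c = 0" for w e
        unfolding gv(3) by (rule array_off_F[OF gv(1,2) none])
      then show ?thesis using supp' by simp
    qed
  next
    case False
    then have i': "q * r \<le> i" by simp
    have off: "x i b c' = 0" if "c' \<noteq> (b + i) mod n" for c'
      using that by (intro supp') (simp add: array_leftover[OF i'])
    \<comment> \<open>A leftover row has one supported cell per column, so the symbol sum alone
      kills it; hence the parameter \<open>0\<close> in \<open>array z 0\<close>.\<close>
    have "(\<Sum>c<n. x i b c) = x i b ((b + i) mod n)"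
      using off n4 by (intro sum_lessThan_eq_1) auto
    then have "x i b c = 0" using symbol[OF i b] off[of c] by (cases "c = (b + i) mod n") auto
    then show ?thesis by (simp add: array_leftover[OF i'])
  qed
  have "z g h v b = 0" if "g < q" "h < q" "v < r" "b < n" for g h v b
  proof (rule kernel_zero[OF _ _ _ _ that])
    show "z g h v b = 0" if "weight q g h b = 0" for g h v b using that by (simp add: z_def)
    show "(\<Sum>c<n. array z 0 i b c) = 0" if "i < n" "b < n" for i b
      using symbol[OF that] x_eq that by simp
    show "(\<Sum>b<n. array z 0 i b c) = 0" if "i < n" "c < n" for i c
      using column[OF that] x_eq that by simp
    show "(\<Sum>i<n. array z 0 i b c) = 0" if "b < n" "c < n" for b c
      using row[OF that] x_eq that by simp
  qed
  then have "array z 0 i0 b0 c0 = 0"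
    using row_split[of i0] bounds by (auto simp: array_def intro!: sum.neutral)
  then show "x i0 b0 c0 = 0" using x_eq bounds by simp
qed

lemma entry_vertex_F:
  assumes "g < q" "h < q" "v < r" "b < n"
  shows "entry vertex (g * r + v) b (F g h v b) = weight q g h b"
proof -
  have "g * r + v < n" using row_index(1)[OF assms(1,3)] qr by linarith
  then show ?thesis
    using array_F[OF assms, of W 1] F_less[OF assms] assms by (simp add: entry_vertex W_def)
qed

text \<open>The two matchings superimposed in a chain row can be separated by support, since their
  classes are disjoint. This makes the choices recoverable from the array.\<close>

lemma F_if_entry_nonzero:
  assumes "g < q" "h < q" "v < r" "b < n" "(b, c) \<in> graph h" "entry vertex (g * r + v) b c \<noteq> 0"
  shows "F g h v b = c"
proof (rule ccontr)
  assume ne: "F g h v b \<noteq> c"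
  have "F g h' v b \<noteq> c" if "h' < q" for h'
    using F_graph[OF assms(1) that assms(3,4)] graph_disjoint[OF _ assms(5) that assms(2)] ne by blast
  then have "array W 1 (g * r + v) b c = 0" by (rule array_off_F[OF assms(1,3)])
  then show False using assms(6) by (simp add: entry_vertex split: if_splits)
qed

end

section \<open>Free choices of 1-factorizations and injectivity\<close>

context block_array
begin

definition pairs :: "(nat \<times> nat) set" where
  "pairs = {(g, h). 3 \<le> g \<and> g < q \<and> (h = g \<or> h = next_class q g)}"

lemma card_pairs: "finite pairs" "card pairs = 2 * (q - 3)"
proof -
  let ?A = "(\<lambda>g. (g, g)) ` {3..<q}" and ?B = "(\<lambda>g. (g, next_class q g)) ` {3..<q}"
  have eq: "pairs = ?A \<union> ?B" by (auto simp: pairs_def)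
  show "finite pairs" by (simp add: eq)
  have "card pairs = card ?A + card ?B"
  proof (unfold eq, rule card_Un_disjoint)
    show "?A \<inter> ?B = {}" using next_class(2)[OF q] by force
  qed simp_all
  also have "card ?A = q - 3" by (subst card_image) (auto intro: inj_onI)
  also have "card ?B = q - 3" by (subst card_image) (auto intro: inj_onI)
  finally show "card pairs = 2 * (q - 3)" by simp
qed

definition choices :: "(nat \<times> nat \<Rightarrow> (nat \<Rightarrow> nat) list) set" where
  "choices = Pi\<^sub>E pairs (\<lambda>p. factorizations n r (graph (snd p)))"

definition family :: "(nat \<times> nat \<Rightarrow> (nat \<Rightarrow> nat) list) \<Rightarrow> nat \<Rightarrow> nat \<Rightarrow> nat \<Rightarrow> nat \<Rightarrow> nat" where
  "family D g h v b = (if (g, h) \<in> pairs then (D (g, h) ! v) b else (b + off h v) mod n)"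

lemma pairs_less: "(g, h) \<in> pairs \<Longrightarrow> g < q \<and> h < q"
  using next_class(1)[OF q] by (auto simp: pairs_def)

lemma bij_shift:
  assumes "d < n"
  shows "bij_betw (\<lambda>b. (b + d) mod n) {..<n} {..<n}"
proof -
  have "inj_on (\<lambda>b. (b + d) mod n) {..<n}"
  proof (rule inj_onI)
    fix b b' assume b: "b \<in> {..<n}" "b' \<in> {..<n}" "(b + d) mod n = (b' + d) mod n"
    have c: "(b + d) mod n < n" using assms by simp
    have "b = ((b + d) mod n + (n - d)) mod n" using add_mod_shift[OF _ c assms, of b] b by simp
    moreover have "b' = ((b + d) mod n + (n - d)) mod n" using add_mod_shift[OF _ c assms, of b'] b by simp
    ultimately show "b = b'" by simp
  qed
  moreover have "(\<lambda>b. (b + d) mod n) ` {..<n} \<subseteq> {..<n}" using assms by auto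
  ultimately show ?thesis by (simp add: bij_betw_def endo_inj_surj)
qed

lemma gadget_family_family:
  assumes D: "D \<in> choices"
  shows "gadget_family n q r (family D)"
proof unfold_locales
  have D': "D (g, h) \<in> factorizations n r (graph h)" if "(g, h) \<in> pairs" for g h
    using PiE_mem[OF D[unfolded choices_def] that] by simp
  have m: "D (g, h) ! v \<in> matchings n {..<n} (graph h)" if "(g, h) \<in> pairs" "v < r" for g h v
    using factorizations_props(2)[OF regular_graph D'] pairs_less that by blast
  have "bij_betw (family D g h v) {..<n} {..<n}" if "g < q" "h < q" "v < r" for g h v
  proof (cases "(g, h) \<in> pairs")
    case True
    then have "family D g h v = D (g, h) ! v" by (simp add: family_def fun_eq_iff)
    then show ?thesis using m[OF True that(3)] by (simp add: matchings_def)
  next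
    case False
    then have "family D g h v = (\<lambda>b. (b + off h v) mod n)" by (simp add: family_def fun_eq_iff)
    then show ?thesis using bij_shift[OF off_less_n[OF that(2,3)]] by simp
  qed
  moreover have "(b, family D g h v b) \<in> graph h" if "g < q" "h < q" "v < r" "b < n" for g h v b
  proof (cases "(g, h) \<in> pairs")
    case True
    then show ?thesis using m[OF True that(3)] that by (simp add: matchings_def family_def)
  next
    case False
    then show ?thesis using that by (auto simp: family_def graph_def)
  qed
  moreover have "\<exists>!v. v < r \<and> family D g h v b = c" if h: "g < q" "h < q" and bc: "(b, c) \<in> graph h" for g h b c
  proof (cases "(g, h) \<in> pairs")
    case True
    then show ?thesis
      using factorizations_props(3)[OF regular_graph[OF h(2)] D'[OF True] bc] by (simp add: family_def)
  next
    case False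
    obtain v where v: "v < r" "c = (b + off h v) mod n" and b: "b < n"
      using bc unfolding graph_def by blast
    show ?thesis
    proof (rule ex1I[of _ v])
      show "v < r \<and> family D g h v b = c" using v False by (simp add: family_def)
      fix w assume w: "w < r \<and> family D g h w b = c"
      then have "(b + off h w) mod n = (b + off h v) mod n" using v False by (simp add: family_def)
      then have "off h w = off h v"
        using add_mod_inj[OF b off_less_n[OF h(2)] off_less_n[OF h(2)]] v w by simp
      then show "w = v" using off_inj v w by blast
    qed
  qed
  ultimately show "factorization_family (family D)"
    unfolding factorization_family_def by blast
  show "family D g h v b = (b + off h v) mod n" if "g < 3" for g h v b
    using that by (simp add: family_def pairs_def)
qed

lemma inj_on_vertex: "inj_on (\<lambda>D. gadget_family.vertex n q r (family D)) choices"
proof (rule inj_onI)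
  fix D E assume D: "D \<in> choices" and E: "E \<in> choices"
    and eq: "gadget_family.vertex n q r (family D) = gadget_family.vertex n q r (family E)"
  interpret D: gadget_family n q r "family D" by (rule gadget_family_family[OF D])
  interpret E: gadget_family n q r "family E" by (rule gadget_family_family[OF E])
  show "D = E"
  proof (rule PiE_ext)
    show "D \<in> Pi\<^sub>E pairs (\<lambda>p. factorizations n r (graph (snd p)))"
      "E \<in> Pi\<^sub>E pairs (\<lambda>p. factorizations n r (graph (snd p)))"
      using D E by (simp_all add: choices_def)
    fix p assume "p \<in> pairs"
    then obtain g h where p: "p = (g, h)" "(g, h) \<in> pairs" by (cases p) auto
    then have gh: "g < q" "h < q" using pairs_less by blast+
    have "D p \<in> factorizations n r (graph h)" "E p \<in> factorizations n r (graph h)"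
      using PiE_mem[OF D[unfolded choices_def] p(2)] PiE_mem[OF E[unfolded choices_def] p(2)] p(1) by simp_all
    note props = this[THEN factorizations_props(1)[OF regular_graph[OF gh(2)]]]
      this[THEN factorizations_props(2)[OF regular_graph[OF gh(2)]]]
    show "D p = E p"
    proof (rule nth_equalityI)
      show "length (D p) = length (E p)" using props(1,2) by simp
      fix v assume "v < length (D p)"
      then have v: "v < r" using props(1) by simp
      show "D p ! v = E p ! v"
      proof
        fix b
        show "(D p ! v) b = (E p ! v) b"
        proof (cases "b < n")
          case True
          have "weight q g h b \<noteq> 0" using p by (auto simp: pairs_def weight_chain)
          then have "entry E.vertex (g * r + v) b (family D g h v b) \<noteq> 0"
            unfolding eq[symmetric] D.entry_vertex_F[OF gh v True] .
          then have "family E g h v b = family D g h v b"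
            by (rule E.F_if_entry_nonzero[OF gh v True D.F_graph[OF gh v True]])
          then show ?thesis using p by (simp add: family_def)
        next
          \<comment> \<open>Matchings are extensional, so they agree outside the column
            range.\<close>
          case False
          then show ?thesis using props(3,4)[OF v] by (auto simp: matchings_def PiE_def extensional_def)
        qed
      qed
    qed
  qed
qed

lemma card_vertices_ge:
  "(real r / exp 2) ^ (r * n * (2 * (q - 3))) \<le> real (card (vertices (tristochastic_polytope n)))"
proof -
  have "(real r / exp 2) ^ (r * n * (2 * (q - 3))) = (\<Prod>p\<in>pairs. (real r / exp 2) ^ (r * n))"
    by (simp add: card_pairs power_mult)
  also have "\<dots> \<le> (\<Prod>p\<in>pairs. real (card (factorizations n r (graph (snd p)))))"
  proof (rule prod_mono)
    fix p assume "p \<in> pairs"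
    then have "snd p < q" using pairs_less by (cases p) auto
    then show "0 \<le> (real r / exp 2) ^ (r * n) \<and>
        (real r / exp 2) ^ (r * n) \<le> real (card (factorizations n r (graph (snd p))))"
      using card_factorizations_ge[OF regular_graph] by simp
  qed
  also have "\<dots> = real (card choices)"
    by (simp add: choices_def card_PiE card_pairs)
  also have "card choices = card ((\<lambda>D. gadget_family.vertex n q r (family D)) ` choices)"
    by (simp add: card_image inj_on_vertex)
  also have "\<dots> \<le> card (vertices (tristochastic_polytope n))"
    using gadget_family.vertex_in_vertices[OF gadget_family_family]
    by (intro card_mono finite_vertices) auto
  finally show ?thesis by simp
qed

end

subsection \<open>Asymptotics\<close>

text \<open>With \<open>x = n\<close>, the number \<open>x / q - 1\<close> is a smooth lower bound
  for \<open>n div q\<close>; the \<open>- 2\<close> is the logarithm of the factor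
  \<open>exp 2\<close> lost per factor \<open>r\<close>.\<close>

lemma growth_limit:
  assumes "0 < (q::real)"
  shows "((\<lambda>x. (x / q - 1) * (ln (x / q - 1) - 2) / (x * ln x)) \<longlongrightarrow> 1 / q) at_top"
proof -
  have "((\<lambda>x::real. 1 / x) \<longlongrightarrow> 0) at_top" "((\<lambda>x::real. 1 / ln x) \<longlongrightarrow> 0) at_top"
    by (auto intro!: tendsto_divide_0[OF tendsto_const] filterlim_at_top_imp_at_infinity ln_at_top filterlim_ident)
  moreover from this have "((\<lambda>x. ln (1 / q - 1 / x)) \<longlongrightarrow> ln (1 / q - 0)) at_top"
    using assms by (intro tendsto_intros) auto
  ultimately have "((\<lambda>x. (1 / q - 1 / x) * (1 + (ln (1 / q - 1 / x) - 2) * (1 / ln x))) \<longlongrightarrow>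
      (1 / q - 0) * (1 + (ln (1 / q - 0) - 2) * 0)) at_top"
    by (intro tendsto_mult tendsto_diff tendsto_add tendsto_const)
  moreover have "eventually (\<lambda>x. (1 / q - 1 / x) * (1 + (ln (1 / q - 1 / x) - 2) * (1 / ln x)) =
      (x / q - 1) * (ln (x / q - 1) - 2) / (x * ln x)) at_top"
    using eventually_gt_at_top[of "max q 1"]
  proof eventually_elim
    case (elim x)
    then have x: "1 < x" "q < x" by auto
    have pos: "0 < 1 / q - 1 / x" using x assms by (simp add: field_simps)
    have eq: "x / q - 1 = x * (1 / q - 1 / x)" using x by (simp add: field_simps)
    have "ln (x / q - 1) = ln x + ln (1 / q - 1 / x)"
      unfolding eq using x pos by (simp add: ln_mult_pos)
    moreover have "0 < ln x" using x by simp
    ultimately show ?case unfolding eq using x by (simp add: divide_simps)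
  qed
  ultimately show ?thesis by (auto elim: Lim_transform_eventually)
qed

theorem theorem3p1:
  shows "\<forall>\<epsilon>::real. \<epsilon> > 0 \<longrightarrow>
    (\<exists>n0::nat. \<forall>n\<ge>n0.
       real (card (vertices (tristochastic_polytope n))) \<ge> real n powr ((2 - \<epsilon>) * (real n)\<^sup>2))"
proof (intro allI impI)
  fix \<epsilon> :: real
  assume \<epsilon>: "\<epsilon> > 0"
  \<comment> \<open>\<open>6 / \<epsilon> < q\<close> gives
    \<open>2 * (q - 3) / q = 2 - 6 / q > 2 - \<epsilon>\<close>.\<close>
  define q where "q = max 4 (nat \<lceil>6 / \<epsilon>\<rceil> + 1)"
  have q4: "4 \<le> q" by (simp add: q_def)
  have "6 / \<epsilon> < real q" unfolding q_def by linarith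
  then have q\<epsilon>: "2 - \<epsilon> < 2 * (real q - 3) * (1 / real q)"
    using \<epsilon> q4 by (simp add: field_simps)
  define s where "s n = real n / real q - 1" for n :: nat
  have lim: "((\<lambda>x. (x / real q - 1) * (ln (x / real q - 1) - 2) / (x * ln x)) \<longlongrightarrow> 1 / real q) at_top"
    using q4 by (intro growth_limit) simp
  have "((\<lambda>n. s n * (ln (s n) - 2) / (real n * ln (real n))) \<longlongrightarrow> 1 / real q) sequentially"
    unfolding s_def using filterlim_compose[OF lim filterlim_real_sequentially] .
  then have "((\<lambda>n. 2 * (real q - 3) * (s n * (ln (s n) - 2) / (real n * ln (real n)))) \<longlongrightarrow>
      2 * (real q - 3) * (1 / real q)) sequentially"
    by (rule tendsto_mult_left)
  then have "eventually (\<lambda>n. 2 - \<epsilon> < 2 * (real q - 3) * (s n * (ln (s n) - 2) / (real n * ln (real n)))) sequentially"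
    using q\<epsilon> by (rule order_tendstoD)
  moreover have "eventually (\<lambda>n. real n \<ge> real q * (exp 2 + 1)) sequentially"
    using filterlim_real_sequentially by (simp add: filterlim_at_top)
  moreover have "eventually (\<lambda>n. n \<ge> (2::nat)) sequentially" by (rule eventually_ge_at_top)
  ultimately have "eventually (\<lambda>n. real (card (vertices (tristochastic_polytope n))) \<ge>
      real n powr ((2 - \<epsilon>) * (real n)\<^sup>2)) sequentially"
  proof eventually_elim
    case (elim n)
    define r where "r = n div q"
    \<comment> \<open>This makes \<open>ln (s n) - 2\<close> nonnegative, so replacing
      \<open>s n\<close> by the larger \<open>r\<close> in both factors only increases the
      product.\<close>
    have s: "exp 2 \<le> s n" using elim(2) q4 by (simp add: s_def field_simps)
    have "real n / real q < real r + 1"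
    proof -
      have "n < q * (r + 1)" using q4 by (simp add: r_def dividend_less_times_div)
      then have "real n < real q * (real r + 1)"
        by (metis of_nat_1 of_nat_add of_nat_less_iff of_nat_mult)
      then show ?thesis using q4 by (simp add: field_simps)
    qed
    then have rs: "s n \<le> real r" by (simp add: s_def)
    have spos: "0 < s n" using s exp_gt_zero[of 2] by linarith
    then have r0: "0 < r" using rs by (cases r) auto
    interpret block_array n q r
      using q4 r0 by unfold_locales (auto simp: r_def)
    have ln_s: "2 \<le> ln (s n)" using s spos by (simp add: ln_ge_iff)
    have ln_n: "0 < real n * ln (real n)" using elim(3) by simp
    have "(2 - \<epsilon>) * (real n * ln (real n)) \<le> 2 * (real q - 3) * (s n * (ln (s n) - 2))"
      using elim(1) unfolding times_divide_eq_right pos_less_divide_eq[OF ln_n] by (rule less_imp_le)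
    also have "\<dots> \<le> 2 * (real q - 3) * (real r * (ln (real r) - 2))"
      using rs spos ln_s q4 r0 by (intro mult_left_mono mult_mono) auto
    finally have "real n * ((2 - \<epsilon>) * (real n * ln (real n))) \<le>
        real n * (2 * (real q - 3) * (real r * (ln (real r) - 2)))"
      by (rule mult_left_mono) simp
    then have le: "(2 - \<epsilon>) * (real n)\<^sup>2 * ln (real n) \<le>
        real (r * n * (2 * (q - 3))) * (ln (real r) - 2)"
      using q4 by (simp add: power2_eq_square of_nat_diff algebra_simps)
    have "real n powr ((2 - \<epsilon>) * (real n)\<^sup>2) = exp ((2 - \<epsilon>) * (real n)\<^sup>2 * ln (real n))"
      using elim(3) by (simp add: powr_def)
    also have "\<dots> \<le> exp (real (r * n * (2 * (q - 3))) * (ln (real r) - 2))"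
      using le by simp
    also have "\<dots> = exp (ln (real r) - 2) ^ (r * n * (2 * (q - 3)))"
      by (rule exp_of_nat_mult)
    also have "exp (ln (real r) - 2) = real r / exp 2"
      using r0 by (simp add: exp_diff)
    finally show ?case using card_vertices_ge by linarith
  qed
  then show "\<exists>n0::nat. \<forall>n\<ge>n0. real (card (vertices (tristochastic_polytope n))) \<ge>
      real n powr ((2 - \<epsilon>) * (real n)\<^sup>2)"
    by (simp add: eventually_sequentially)
qed

end
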